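(* Let $n\ge 3$ and let $\widehat{M}$ be an $n$-dimensional pseudo-manifold with triangulation $(\widetilde{\Delta},\Phi,p)$. Let $M=\widehat{M}\setminus\widehat{M}^{(0)}$, let $\sigma_0$ be an $n$-simplex of $\widetilde{\Delta}$, and let $x_0$ be the image in $\widehat{M}$ of the barycentre of $\sigma_0$. The assignment $$\pi_1(M,x_0)\ni[\gamma]\mapsto p_\gamma\in \mathrm{Sym}(\sigma_0),$$ where $\gamma$ is a loop in the dual 1-skeleton based at $x_0$ and $p_\gamma$ is the associated projectivity, is a well-defined homomorphism if and only if the triangulation of $\widehat{M}$ is even.
   Context: Triangulations. Let $\widetilde{\Delta}$ be a finite union of pairwise disjoint, oriented Euclidean $n$-simplices. A facet is an $(n-1)$-simplex of $\widetilde\Delta$, a corner is a $0$-simplex; for a simplex $\tau$, $\sigma_\tau$ is the unique $n$-simplex containing it (if $\tau$ is a facet, $\sigma_\tau$ has a unique corner opposite $\tau$). Let $\Phi$ be a family of orientation-reversing affine isomorphisms ("face pairings") between facets such that $\varphi\in\Phi$ iff $\varphi^{-1}\in\Phi$ and every facet $\tau$ is the domain of a unique element $\varphi_\tau\in\Phi$. The quotient $\widehat{M}=\widetilde{\Delta}/\Phi$, with quotient map $p$, is a closed orientable $n$-dimensional pseudo-manifold, always assumed connected, and $(\widetilde{\Delta},\Phi,p)$ is a (singular) triangulation of it. The image of a $k$-simplex under $p$ is a $k$-singlex; its degree is the degree of the restriction $p\colon p^{-1}(\tau)\to\tau$ (the number of $k$-simplices of $\widetilde\Delta$ mapped onto it).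 The triangulation is even if every $(n-2)$-singlex has even degree. $\widehat{M}^{(k)}$ is the image of the $k$-skeleton. Dual skeleta. The dual 1-skeleton (dual graph) has a vertex for each $n$-singlex (its barycentre) and an edge for each $(n-1)$-singlex. The dual 2-skeleton has in addition one 2-cell for each $(n-2)$-singlex. Standing convention: $\pi_1(M,x_0)$ is presented with generators represented by loops in the dual 1-skeleton and relators arising from the cells of the dual 2-skeleton. Projectivities. For a facet $\tau$, the perspectivity $p_\tau\colon\sigma_\tau\to\sigma_{\varphi_\tau(\tau)}$ is the bijection of vertex sets sending each vertex $w$ of $\tau$ to $\varphi_\tau(w)$ and the corner opposite $\tau$ to the corner of $\sigma_{\varphi_\tau(\tau)}$ opposite $\varphi_\tau(\tau)$. A loop $\gamma$ in the dual 1-skeleton based at $x_0$ crosses a sequence of facets $\tau_0,\tau_1,\dots,\tau_k$ (with $\tau_0\subset\sigma_0$, and $\tau_{j+1}$ in the same $n$-simplex as $\varphi_{\tau_j}(\tau_j)$), and its projectivity is $p_\gamma=p_{\tau_k}\circ\cdots\circ p_{\tau_0}$, a permutation of the vertex set of $\sigma_0$; $\mathrm{Sym}(\sigma_0)$ is the group of permutations of the vertices of $\sigma_0$. Products in $\pi_1$ and in $\mathrm{Sym}(\sigma_0)$ are taken in compatible order.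
   Formalization: The quotient map p is also required to be injective on open simplices of codimension at most 2 (otherwise the claim fails for n=4), and π₁(M,x₀) means the group presented by dual loops modulo dual 2-cells, which for n≥4 may differ from the topological fundamental group. *)

theory Defs
  imports "HOL-Analysis.Analysis" "HOL-Algebra.Bij" "HOL-Combinatorics.Permutations"
begin

section \<open>Gluing data\<close>

text \<open>
  A Euclidean simplex is represented by its set of vertices \<open>\<tau>\<close>; the simplex itself is
  \<open>convex hull \<tau>\<close>. The disjoint union of \<open>n\<close>-simplices lives in some Euclidean space \<open>'e\<close>, whose
  dimension is only required to be large enough to contain it, not to be equal to \<open>n\<close>.

  \<^item> \<open>orientation \<sigma>\<close> lists the vertices of \<open>\<sigma>\<close> in a positively oriented order; only its class
    modulo even permutations is ever used.
  \<^item> \<open>pairing \<tau>\<close> is the face pairing whose domain is the facet \<open>\<tau>\<close>; only its values on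
    \<open>convex hull \<tau>\<close> are ever used.
\<close>

record 'e gluing =
  gdim :: nat
  simplices :: "'e set set"
  orientation :: "'e set \<Rightarrow> 'e list"
  pairing :: "'e set \<Rightarrow> 'e \<Rightarrow> 'e"

definition faces :: "'e gluing \<Rightarrow> nat \<Rightarrow> 'e set set" where
  "faces T k = {\<tau>. (\<exists>\<sigma>\<in>simplices T. \<tau> \<subseteq> \<sigma>) \<and> card \<tau> = k + 1}"

definition facets :: "'e gluing \<Rightarrow> 'e set set" where
  "facets T = faces T (gdim T - 1)"

definition simplex_of :: "'e gluing \<Rightarrow> 'e set \<Rightarrow> 'e set" where
  "simplex_of T \<tau> = (THE \<sigma>. \<sigma> \<in> simplices T \<and> \<tau> \<subseteq> \<sigma>)"

definition opposite :: "'e gluing \<Rightarrow> 'e set \<Rightarrow> 'e" where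
  "opposite T \<tau> = (THE v. v \<in> simplex_of T \<tau> - \<tau>)"

definition mate :: "'e gluing \<Rightarrow> 'e set \<Rightarrow> 'e set" where
  "mate T \<tau> = pairing T \<tau> ` \<tau>"

text \<open>
  The ordering \<open>ws\<close> of the vertices of the facet \<open>\<tau>\<close> is positive for the orientation that \<open>\<tau>\<close>
  inherits from the simplex containing it as part of its boundary.
\<close>

definition positive :: "'e gluing \<Rightarrow> 'e set \<Rightarrow> 'e list \<Rightarrow> bool" where
  "positive T \<tau> ws \<longleftrightarrow>
     (\<exists>q. q permutes {..<gdim T + 1} \<and> evenperm q \<and>
          opposite T \<tau> # ws = permute_list q (orientation T (simplex_of T \<tau>)))"

section \<open>The quotient pseudo-manifold and its singlices\<close>

definition total_space :: "'e::euclidean_space gluing \<Rightarrow> 'e set" where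
  "total_space T = (\<Union>\<sigma>\<in>simplices T. convex hull \<sigma>)"

definition glue :: "'e::euclidean_space gluing \<Rightarrow> 'e rel" where
  "glue T = {(x, pairing T \<tau> x) | x \<tau>. \<tau> \<in> facets T \<and> x \<in> convex hull \<tau>}"

definition quot :: "'e::euclidean_space gluing \<Rightarrow> 'e \<Rightarrow> 'e set" where
  "quot T x = (glue T \<union> (glue T)\<inverse>)\<^sup>* `` {x}"

definition quotient_space :: "'e::euclidean_space gluing \<Rightarrow> 'e set topology" where
  "quotient_space T =
     topology (\<lambda>U. U \<subseteq> quot T ` total_space T \<and>
                   openin (top_of_set (total_space T)) {x \<in> total_space T. quot T x \<in> U})"

lemma quotient_map_quot: "quotient_map (top_of_set (total_space T)) (quotient_space T) (quot T)"
proof -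
  let ?X = "total_space T"
  let ?P = "\<lambda>U. U \<subseteq> quot T ` ?X \<and> openin (top_of_set ?X) {x \<in> ?X. quot T x \<in> U}"
  have "istopology ?P"
    unfolding istopology_def
  proof (intro conjI allI impI)
    fix S U assume SU: "?P S" "?P U"
    have "{x \<in> ?X. quot T x \<in> S \<inter> U} = {x \<in> ?X. quot T x \<in> S} \<inter> {x \<in> ?X. quot T x \<in> U}"
      by auto
    with SU show "openin (top_of_set ?X) {x \<in> ?X. quot T x \<in> S \<inter> U}"
      by (simp only: openin_Int)
  next
    fix K assume K: "\<forall>U\<in>K. ?P U"
    have "{x \<in> ?X. quot T x \<in> \<Union>K} = (\<Union>U\<in>K. {x \<in> ?X. quot T x \<in> U})"
      by auto
    with K show "openin (top_of_set ?X) {x \<in> ?X. quot T x \<in> \<Union>K}"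
      by (metis (no_types, lifting) imageE openin_Union)
  qed auto
  then have op: "openin (quotient_space T) = ?P"
    by (simp add: quotient_space_def topology_inverse')
  have "{x \<in> ?X. quot T x \<in> quot T ` ?X} = ?X"
    by auto
  then have "topspace (quotient_space T) = quot T ` ?X"
    unfolding topspace_def op by fastforce
  then show ?thesis
    by (simp add: quotient_map_def op)
qed

definition singlex :: "'e::euclidean_space gluing \<Rightarrow> 'e set \<Rightarrow> 'e set set" where
  "singlex T \<tau> = quot T ` (convex hull \<tau>)"

definition singlex_degree :: "'e::euclidean_space gluing \<Rightarrow> nat \<Rightarrow> 'e set set \<Rightarrow> nat" where
  "singlex_degree T k s = card {\<tau> \<in> faces T k. singlex T \<tau> = s}"

definition even_triangulation :: "'e::euclidean_space gluing \<Rightarrow> bool" where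
  "even_triangulation T \<longleftrightarrow>
     (\<forall>\<rho>\<in>faces T (gdim T - 2). even (singlex_degree T (gdim T - 2) (singlex T \<rho>)))"

text \<open>
  Since \<open>pairing T\<close> is a family indexed by the facets, every facet is the domain of exactly one
  face pairing; \<open>pairing_inverse\<close> says that the family is closed under inverses.

  \<open>quot_inj\<close> is the usual requirement on a singular triangulation that the quotient map does not
  identify distinct points in the interior of one and the same simplex; it is imposed only in
  codimension at most 2, and it is automatic in codimension 0. It is what makes the
  degree of the restriction of the quotient map over a singlex equal to the number of simplices
  mapped onto that singlex. In codimension 1 it excludes a facet folded onto itself by a reflection
  (so each codimension-one singlex is the image of two facets); in codimension 2 it excludes
  a face that returns to itself with its vertices permuted after one turn around it, which for
  \<open>n \<ge> 4\<close> the orientation condition does not exclude.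
\<close>

locale singular_triangulation =
  fixes T :: "'e::euclidean_space gluing"
  assumes finite_simplices: "finite (simplices T)"
    and simplex_indep: "\<sigma> \<in> simplices T \<Longrightarrow> \<not> affine_dependent \<sigma>"
    and simplex_card: "\<sigma> \<in> simplices T \<Longrightarrow> card \<sigma> = gdim T + 1"
    and simplices_disjoint:
      "\<lbrakk>\<sigma> \<in> simplices T; \<sigma>' \<in> simplices T; \<sigma> \<noteq> \<sigma>'\<rbrakk> \<Longrightarrow> convex hull \<sigma> \<inter> convex hull \<sigma>' = {}"
    and orientation_ordering:
      "\<sigma> \<in> simplices T \<Longrightarrow> distinct (orientation T \<sigma>) \<and> set (orientation T \<sigma>) = \<sigma>"
    and pairing_affine:
      "\<tau> \<in> facets T \<Longrightarrow> \<exists>L c. linear L \<and> (\<forall>x\<in>convex hull \<tau>. pairing T \<tau> x = L x + c)"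
    and pairing_facet: "\<tau> \<in> facets T \<Longrightarrow> mate T \<tau> \<in> facets T"
    and pairing_inverse:
      "\<lbrakk>\<tau> \<in> facets T; x \<in> convex hull \<tau>\<rbrakk> \<Longrightarrow> pairing T (mate T \<tau>) (pairing T \<tau> x) = x"
    and pairing_orientation:
      "\<lbrakk>\<tau> \<in> facets T; positive T \<tau> ws\<rbrakk> \<Longrightarrow> \<not> positive T (mate T \<tau>) (map (pairing T \<tau>) ws)"
    and quot_inj:
      "\<lbrakk>\<tau> \<in> faces T k; gdim T \<le> k + 2\<rbrakk> \<Longrightarrow> inj_on (quot T) (rel_interior (convex hull \<tau>))"
    and quotient_connected: "connected_space (quotient_space T)"

section \<open>The dual 2-skeleton and its fundamental group\<close>

text \<open>
  A path in the dual 1-skeleton is the list of facets through which it leaves the successive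
  \<open>n\<close>-simplices: the oriented dual edges are the facets, and \<open>mate T \<tau>\<close> is the reverse of the dual
  edge \<open>\<tau>\<close>. The empty list is the constant path.
\<close>

fun dual_path :: "'e gluing \<Rightarrow> 'e set \<Rightarrow> 'e set list \<Rightarrow> 'e set \<Rightarrow> bool" where
  "dual_path T \<sigma> [] \<sigma>' \<longleftrightarrow> \<sigma> = \<sigma>'"
| "dual_path T \<sigma> (\<tau> # \<gamma>) \<sigma>' \<longleftrightarrow>
     \<tau> \<in> facets T \<and> \<tau> \<subseteq> \<sigma> \<and> dual_path T (simplex_of T (mate T \<tau>)) \<gamma> \<sigma>'"

definition dual_loops :: "'e gluing \<Rightarrow> 'e set \<Rightarrow> 'e set list set" where
  "dual_loops T \<sigma>0 = {\<gamma>. dual_path T \<sigma>0 \<gamma> \<sigma>0}"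

text \<open>
  Turning around a codimension-two face: from the pair of a codimension-two face \<open>\<rho>\<close> and a facet \<open>\<tau>\<close>
  containing it, cross \<open>\<tau>\<close>, follow \<open>\<rho>\<close> into the next simplex, and select the other facet of that
  simplex containing the image of \<open>\<rho>\<close>.
\<close>

definition turn :: "'e gluing \<Rightarrow> 'e set \<times> 'e set \<Rightarrow> 'e set \<times> 'e set" where
  "turn T = (\<lambda>(\<rho>, \<tau>). (pairing T \<tau> ` \<rho>,
     THE \<tau>'. \<tau>' \<in> facets T \<and> pairing T \<tau> ` \<rho> \<subseteq> \<tau>' \<and> \<tau>' \<noteq> mate T \<tau>))"

definition turn_period :: "'e gluing \<Rightarrow> 'e set \<times> 'e set \<Rightarrow> nat" where
  "turn_period T f = (LEAST d. 0 < d \<and> (turn T ^^ d) f = f)"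

text \<open>
  The boundary loops of the dual 2-cells. Each 2-cell, that is, each codimension-two singlex, occurs
  here with every choice of starting vertex and of direction on its boundary.
\<close>

definition cell_boundaries :: "'e gluing \<Rightarrow> 'e set list set" where
  "cell_boundaries T =
     {map (\<lambda>j. snd ((turn T ^^ j) (\<rho>, \<tau>))) [0..<turn_period T (\<rho>, \<tau>)] | \<rho> \<tau>.
        \<rho> \<in> faces T (gdim T - 2) \<and> \<tau> \<in> facets T \<and> \<rho> \<subseteq> \<tau>}"

definition elementary_moves :: "'e gluing \<Rightarrow> 'e set \<Rightarrow> 'e set list rel" where
  "elementary_moves T \<sigma>0 =
     {(u @ [\<tau>, mate T \<tau>] @ v, u @ v) | u v \<tau>. u @ [\<tau>, mate T \<tau>] @ v \<in> dual_loops T \<sigma>0} \<union>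
     {(u @ c @ v, u @ v) | u v c. c \<in> cell_boundaries T \<and> u @ c @ v \<in> dual_loops T \<sigma>0}"

definition loop_class :: "'e gluing \<Rightarrow> 'e set \<Rightarrow> 'e set list \<Rightarrow> 'e set list set" where
  "loop_class T \<sigma>0 \<gamma> = (elementary_moves T \<sigma>0 \<union> (elementary_moves T \<sigma>0)\<inverse>)\<^sup>* `` {\<gamma>}"

text \<open>
  The group generated by the loops in the dual 1-skeleton, based at the barycentre of \<open>\<sigma>0\<close>, with
  relators given by the dual 2-cells. In the product \<open>[\<gamma>] [\<delta>]\<close> the loop \<open>\<delta>\<close> is traversed
  first, in agreement with the composition of functions that is the product in \<open>BijGroup\<close>.

  For \<open>n = 3\<close> this is the fundamental group of the quotient space with the 0-skeleton removed. For
  \<open>n \<ge> 4\<close> it has that fundamental group as a quotient, possibly a proper one, for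
  instance when the link of a face of positive dimension and codimension at least three is not
  simply connected.
\<close>

definition pi1 :: "'e gluing \<Rightarrow> 'e set \<Rightarrow> 'e set list set monoid" where
  "pi1 T \<sigma>0 =
     \<lparr>carrier = loop_class T \<sigma>0 ` dual_loops T \<sigma>0,
      mult = (\<lambda>a b. \<Union>\<gamma>\<in>a. \<Union>\<delta>\<in>b. loop_class T \<sigma>0 (\<delta> @ \<gamma>)),
      one = loop_class T \<sigma>0 []\<rparr>"

section \<open>Projectivities\<close>

text \<open>Meaningful only for arguments \<open>w\<close> in \<open>simplex_of T \<tau>\<close>.\<close>

definition perspectivity :: "'e gluing \<Rightarrow> 'e set \<Rightarrow> 'e \<Rightarrow> 'e" where
  "perspectivity T \<tau> w = (if w \<in> \<tau> then pairing T \<tau> w else opposite T (mate T \<tau>))"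

definition projectivity :: "'e gluing \<Rightarrow> 'e set \<Rightarrow> 'e set list \<Rightarrow> 'e \<Rightarrow> 'e" where
  "projectivity T \<sigma>0 \<gamma> = (\<lambda>w\<in>\<sigma>0. fold (perspectivity T) \<gamma> w)"

end

theory Submission
  imports Defs
begin

text \<open>
  A \<^emph>\<open>flag\<close> is a codimension-two face \<open>\<rho>\<close> together with a facet \<open>\<tau> \<supseteq> \<rho>\<close>. Two involutions act
  on flags: \<open>flip\<close> replaces \<open>\<tau>\<close> by the other facet of its simplex through \<open>\<rho>\<close>, and \<open>cross\<close> applies
  the pairing of \<open>\<tau>\<close>. Both are free, the second one because the pairing reverses orientation, and
  turning around \<open>\<rho>\<close> is \<open>flip \<circ> cross\<close>. The dihedral relations therefore prevent a turn orbit from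
  meeting the flip of one of its members, so the faces met during one period are pairwise
  distinct, and the degree of the singlex of \<open>\<rho>\<close> is the period.

  Along one period the perspectivities restrict to an affine self-map of \<open>\<rho>\<close> compatible with the
  quotient map, which is the identity, and each single step exchanges the roles of the two
  vertices off \<open>\<rho>\<close>. So the projectivity of the boundary of a dual 2-cell is trivial if the degree is
  even, and a transposition otherwise. Since the dual graph is connected, a conjugate of every
  cell boundary occurs among the loops at the base point.
\<close>

text \<open>If \<open>t^j x = a x\<close> with \<open>j \<ge> 2\<close>, stripping a factor
  \<open>t\<close> on either side gives the same relation for \<open>t x\<close> and
  \<open>j - 2\<close>. The descent ends in a fixed point of \<open>a\<close> when
  \<open>j = 0\<close> or of \<open>b\<close> when \<open>j = 1\<close>, and neither exists.\<close>

lemma funpow_comp_involutions_neq: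
  assumes a: "\<And>x. x \<in> S \<Longrightarrow> a x \<in> S \<and> a (a x) = x \<and> a x \<noteq> x"
    and b: "\<And>x. x \<in> S \<Longrightarrow> b x \<in> S \<and> b (b x) = x \<and> b x \<noteq> x"
    and t: "\<And>x. x \<in> S \<Longrightarrow> t x = a (b x)"
    and "x \<in> S"
  shows "(t ^^ j) x \<noteq> a x"
  using \<open>x \<in> S\<close>
proof (induction j arbitrary: x rule: less_induct)
  case (less j)
  have tS: "(t ^^ i) y \<in> S" if "y \<in> S" for i y
    using that by (induction i) (auto simp: t a b)
  consider "j = 0" | "j = 1" | i where "j = Suc (Suc i)"
    by (metis One_nat_def not0_implies_Suc)
  then show ?case
  proof cases
    case 1
    then show ?thesis using a[OF less.prems] by auto
  next
    case 2
    have "b x \<in> S" "b x \<noteq> x" using b[OF less.prems] by auto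
    then have "a (b x) \<noteq> a x" using a less.prems by metis
    then show ?thesis using 2 t[OF less.prems] by simp
  next
    case 3
    let ?y = "(t ^^ i) (t x)"
    have tx: "t x \<in> S" using tS[OF less.prems, of 1] by simp
    then have y: "?y \<in> S" by (rule tS)
    have "?y \<noteq> a (t x)" using less.IH[of i "t x"] tx 3 by simp
    moreover have "a (t x) = b x" using t a b less.prems by simp
    moreover have "(t ^^ j) x = t ?y" using 3 by (metis funpow_simps_right(2) funpow.simps(2) comp_apply)
    ultimately show ?thesis using t[OF y] a b y less.prems by metis
  qed
qed

lemma funpow_add_apply: "(f ^^ (m + n)) x = (f ^^ m) ((f ^^ n) x)"
  by (simp add: funpow_add)

text \<open>A face of a convex set contains every convex subset whose relative interior it meets.
  Vertices of the simplex are extreme points, so containment of hulls passes to vertex sets.\<close>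

lemma subset_if_rel_interior_meets:
  fixes \<sigma> :: "'a::euclidean_space set"
  assumes "\<not> affine_dependent \<sigma>" "\<rho> \<subseteq> \<sigma>" "\<tau> \<subseteq> \<sigma>"
    and "x \<in> rel_interior (convex hull \<rho>)" "x \<in> convex hull \<tau>"
  shows "\<rho> \<subseteq> \<tau>"
proof
  fix v assume v: "v \<in> \<rho>"
  have face: "convex hull \<tau> face_of convex hull \<sigma>"
    by (intro iffD2[OF face_of_convex_hull_affine_independent[OF assms(1)]] exI[of _ \<tau>] conjI assms refl)
  moreover have "convex hull \<rho> \<subseteq> convex hull \<sigma>" by (simp add: assms hull_mono)
  moreover have "convex hull \<tau> \<inter> rel_interior (convex hull \<rho>) \<noteq> {}"
    using assms(4,5) by blast
  ultimately have "convex hull \<rho> \<subseteq> convex hull \<tau>"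
    by (rule subset_of_face_of)
  then have "v \<in> convex hull \<tau>" by (rule subsetD) (rule hull_inc[OF v])
  moreover have "v extreme_point_of (convex hull \<sigma>)"
    using assms(2) v by (simp only: extreme_point_of_convex_hull_affine_independent[OF assms(1)] subsetD)
  ultimately have "v extreme_point_of (convex hull \<tau>)"
    by (simp only: extreme_point_of_face[OF face])
  then show "v \<in> \<tau>" by (rule extreme_point_of_convex_hull)
qed

text \<open>Pairings are known to be affine only on the hull of their facet, so the facts on linear
  images and translations are transferred through subsets of that hull.\<close>

lemma rel_interior_convex_hull_affine_image:
  fixes \<rho> :: "'a::euclidean_space set" and g :: "'a \<Rightarrow> 'b::euclidean_space"
  assumes L: "linear L" and g: "\<And>y. y \<in> convex hull \<rho> \<Longrightarrow> g y = L y + c"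
  shows "g ` (convex hull \<rho>) = convex hull (g ` \<rho>)"
    and "g ` rel_interior (convex hull \<rho>) = rel_interior (convex hull (g ` \<rho>))"
proof -
  have eq: "g ` A = (+) c ` L ` A" if "A \<subseteq> convex hull \<rho>" for A
    unfolding image_image by (rule image_cong) (use g that in \<open>simp_all add: subset_iff add.commute\<close>)
  have \<rho>: "g ` \<rho> = (+) c ` L ` \<rho>" by (rule eq) (rule hull_subset)
  show "g ` (convex hull \<rho>) = convex hull (g ` \<rho>)"
    unfolding \<rho> convex_hull_translation convex_hull_linear_image[OF L, symmetric]
    by (rule eq) (rule subset_refl)
  have "g ` rel_interior (convex hull \<rho>) = (+) c ` L ` rel_interior (convex hull \<rho>)"
    by (rule eq) (rule rel_interior_subset)
  also have "L ` rel_interior (convex hull \<rho>) = rel_interior (convex hull (L ` \<rho>))"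
    unfolding convex_hull_linear_image[OF L, symmetric]
    by (simp only: rel_interior_convex_linear_image[OF L] convex_convex_hull)
  finally show "g ` rel_interior (convex hull \<rho>) = rel_interior (convex hull (g ` \<rho>))"
    by (simp only: \<rho> convex_hull_translation rel_interior_translation)
qed

text \<open>A face of codimension two has one vertex less than the dimension; the sum form avoids
  truncated subtraction.\<close>

definition flags :: "'e gluing \<Rightarrow> ('e set \<times> 'e set) set" where
  "flags T = {(\<rho>, \<tau>). \<tau> \<in> facets T \<and> \<rho> \<subseteq> \<tau> \<and> card \<rho> + 1 = gdim T}"

definition flip :: "'e gluing \<Rightarrow> 'e set \<times> 'e set \<Rightarrow> 'e set \<times> 'e set" where
  "flip T = (\<lambda>(\<rho>, \<tau>). (\<rho>, insert (opposite T \<tau>) \<rho>))"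

definition cross :: "'e gluing \<Rightarrow> 'e set \<times> 'e set \<Rightarrow> 'e set \<times> 'e set" where
  "cross T = (\<lambda>(\<rho>, \<tau>). (pairing T \<tau> ` \<rho>, mate T \<tau>))"

text \<open>The length is left free so that turning can be studied by induction; the boundary of a
  dual 2-cell is the case of one full period.\<close>

definition turn_path :: "'e gluing \<Rightarrow> 'e set \<times> 'e set \<Rightarrow> nat \<Rightarrow> 'e set list" where
  "turn_path T f k = map (\<lambda>j. snd ((turn T ^^ j) f)) [0..<k]"

text \<open>The bound makes codimension-two faces nonempty, so that each determines its simplex, and
  gives every simplex at least three vertices.\<close>

locale triangulation_dim_ge_2 = singular_triangulation +
  assumes dim_ge_2: "2 \<le> gdim T"
begin

section \<open>Simplices, facets and face pairings\<close>

lemma simplex_of_eq: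
  assumes "\<sigma> \<in> simplices T" "\<tau> \<subseteq> \<sigma>" "\<tau> \<noteq> {}"
  shows "simplex_of T \<tau> = \<sigma>"
  unfolding simplex_of_def
proof (rule the_equality)
  fix \<sigma>' assume "\<sigma>' \<in> simplices T \<and> \<tau> \<subseteq> \<sigma>'"
  moreover obtain v where v: "v \<in> \<tau>" using assms by blast
  ultimately have "v \<in> convex hull \<sigma> \<inter> convex hull \<sigma>'" "\<sigma>' \<in> simplices T"
    using assms(2) by (auto simp: hull_inc)
  then show "\<sigma>' = \<sigma>" using simplices_disjoint assms(1) by blast
qed (use assms in blast)

lemma finite_simplex: "\<sigma> \<in> simplices T \<Longrightarrow> finite \<sigma>"
  using simplex_card card.infinite by fastforce

lemma facetD:
  assumes "\<tau> \<in> facets T"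
  shows "simplex_of T \<tau> \<in> simplices T" "\<tau> \<subseteq> simplex_of T \<tau>" "card \<tau> = gdim T"
    "finite \<tau>" "\<tau> \<noteq> {}"
proof -
  obtain \<sigma> where \<sigma>: "\<sigma> \<in> simplices T" "\<tau> \<subseteq> \<sigma>" and c: "card \<tau> = gdim T"
    using assms dim_ge_2 by (auto simp: facets_def faces_def)
  show "card \<tau> = gdim T" "finite \<tau>" "\<tau> \<noteq> {}"
    using c dim_ge_2 \<sigma> finite_simplex finite_subset by auto
  then have "simplex_of T \<tau> = \<sigma>" by (intro simplex_of_eq \<sigma>)
  then show "simplex_of T \<tau> \<in> simplices T" "\<tau> \<subseteq> simplex_of T \<tau>" using \<sigma> by auto
qed

lemma facetI: "\<sigma> \<in> simplices T \<Longrightarrow> \<tau> \<subseteq> \<sigma> \<Longrightarrow> card \<tau> = gdim T \<Longrightarrow> \<tau> \<in> facets T"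
  using dim_ge_2 by (auto simp: facets_def faces_def)

lemma opposite_eq:
  assumes "\<sigma> \<in> simplices T" "\<sigma> = insert x \<tau>" "x \<notin> \<tau>" "\<tau> \<noteq> {}"
  shows "opposite T \<tau> = x"
proof -
  have "simplex_of T \<tau> = \<sigma>" using assms by (intro simplex_of_eq) auto
  then show ?thesis unfolding opposite_def using assms by auto
qed

lemma opposite:
  assumes "\<tau> \<in> facets T"
  shows "simplex_of T \<tau> = insert (opposite T \<tau>) \<tau>" "opposite T \<tau> \<notin> \<tau>"
proof -
  note \<tau> = facetD[OF assms]
  have "card (simplex_of T \<tau> - \<tau>) = 1"
    using \<tau> simplex_card by (simp add: card_Diff_subset)
  then obtain x where x: "simplex_of T \<tau> - \<tau> = {x}" using card_1_singletonE by blast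
  then have "simplex_of T \<tau> = insert x \<tau>" "x \<notin> \<tau>" using \<tau> by auto
  moreover from this have "opposite T \<tau> = x" by (intro opposite_eq[OF \<tau>(1)] \<tau>(5))
  ultimately show "simplex_of T \<tau> = insert (opposite T \<tau>) \<tau>" "opposite T \<tau> \<notin> \<tau>" by auto
qed

lemma pairing_inverse_vertex:
  "\<tau> \<in> facets T \<Longrightarrow> v \<in> \<tau> \<Longrightarrow> pairing T (mate T \<tau>) (pairing T \<tau> v) = v"
  by (simp add: pairing_inverse hull_inc)

lemma mate_mate: "\<tau> \<in> facets T \<Longrightarrow> mate T (mate T \<tau>) = \<tau>"
proof -
  assume \<tau>: "\<tau> \<in> facets T"
  have "mate T (mate T \<tau>) = (\<lambda>v. pairing T (mate T \<tau>) (pairing T \<tau> v)) ` \<tau>"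
    unfolding mate_def[of T "mate T \<tau>"] by (subst (2) mate_def) (rule image_image)
  then show ?thesis using pairing_inverse_vertex[OF \<tau>] by simp
qed

lemma inj_on_pairing: "\<tau> \<in> facets T \<Longrightarrow> inj_on (pairing T \<tau>) \<tau>"
  by (rule inj_on_inverseI) (rule pairing_inverse_vertex)

lemma pairing_hull:
  assumes "\<tau> \<in> facets T" "\<rho> \<subseteq> \<tau>"
  shows "pairing T \<tau> ` (convex hull \<rho>) = convex hull (pairing T \<tau> ` \<rho>)"
    and "pairing T \<tau> ` rel_interior (convex hull \<rho>) = rel_interior (convex hull (pairing T \<tau> ` \<rho>))"
proof -
  obtain L c where L: "linear L" and c: "\<forall>x\<in>convex hull \<tau>. pairing T \<tau> x = L x + c"
    using pairing_affine[OF assms(1)] by auto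
  have g: "pairing T \<tau> x = L x + c" if "x \<in> convex hull \<rho>" for x
    using c subsetD[OF hull_mono[OF assms(2)] that] by (rule bspec)
  show "pairing T \<tau> ` (convex hull \<rho>) = convex hull (pairing T \<tau> ` \<rho>)"
    by (rule rel_interior_convex_hull_affine_image(1)[OF L]) (rule g)
  show "pairing T \<tau> ` rel_interior (convex hull \<rho>) = rel_interior (convex hull (pairing T \<tau> ` \<rho>))"
    by (rule rel_interior_convex_hull_affine_image(2)[OF L]) (rule g)
qed

section \<open>Points of the quotient\<close>

lemma sym_glue: "(x, y) \<in> glue T \<Longrightarrow> (y, x) \<in> glue T"
proof -
  assume "(x, y) \<in> glue T"
  then obtain \<tau> where \<tau>: "\<tau> \<in> facets T" "x \<in> convex hull \<tau>" "y = pairing T \<tau> x"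
    by (auto simp: glue_def)
  have "y \<in> convex hull (mate T \<tau>)"
    unfolding mate_def pairing_hull(1)[OF \<tau>(1) subset_refl, symmetric] \<tau>(3) using \<tau>(2) by (rule imageI)
  moreover have "x = pairing T (mate T \<tau>) y"
    using pairing_inverse[OF \<tau>(1,2)] \<tau>(3) by simp
  ultimately show "(y, x) \<in> glue T" using pairing_facet[OF \<tau>(1)] unfolding glue_def by (intro CollectI exI[of _ y] exI[of _ "mate T \<tau>"]) simp
qed

lemma glue_Un_converse: "glue T \<union> (glue T)\<inverse> = glue T"
  by (intro equalityI subrelI) (auto intro: sym_glue)

text \<open>Gluing is symmetric, so its reflexive transitive closure is already an equivalence
  relation, and identified points can be followed along chains of single pairings.\<close>

lemma quot_eq_iff: "quot T x = quot T y \<longleftrightarrow> (x, y) \<in> (glue T)\<^sup>*"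
proof -
  have "equiv UNIV ((glue T)\<^sup>*)"
    unfolding equiv_def using sym_rtrancl[OF symI[OF sym_glue]] by (simp add: refl_rtrancl trans_rtrancl)
  then show ?thesis unfolding quot_def glue_Un_converse by (simp add: equiv_class_eq_iff)
qed

lemma quot_pairing:
  "\<tau> \<in> facets T \<Longrightarrow> x \<in> convex hull \<tau> \<Longrightarrow> quot T (pairing T \<tau> x) = quot T x"
proof -
  assume "\<tau> \<in> facets T" "x \<in> convex hull \<tau>"
  then have "(x, pairing T \<tau> x) \<in> glue T" by (auto simp: glue_def)
  then have "quot T x = quot T (pairing T \<tau> x)" by (intro iffD2[OF quot_eq_iff] r_into_rtrancl)
  then show ?thesis ..
qed

text \<open>The self-map displaces the interior point weighted towards \<open>w\<close> by a multiple of
  \<open>g w - w\<close>, as the sum over all vertices is invariant.\<close>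

lemma self_gluing_trivial:
  assumes \<tau>: "\<tau> \<in> faces T k" "gdim T \<le> k + 2"
    and L: "linear L" and g: "\<And>x. x \<in> convex hull \<tau> \<Longrightarrow> g x = L x + c"
    and g\<tau>: "g ` \<tau> = \<tau>" and q: "\<And>x. x \<in> convex hull \<tau> \<Longrightarrow> quot T (g x) = quot T x"
    and w: "w \<in> \<tau>"
  shows "g w = w"
proof -
  \<comment> \<open>In \<open>pt v\<close> below the vertex \<open>v\<close> has weight
    \<open>2/m\<close> and every other vertex \<open>1/m\<close>. With this \<open>m\<close> the
    weights are positive and sum to 1, so the point lies in the relative interior.\<close>
  define m where "m = real (card \<tau> + 1)"
  obtain \<sigma> where \<sigma>: "\<sigma> \<in> simplices T" "\<tau> \<subseteq> \<sigma>" using \<tau> by (auto simp: faces_def)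
  have fin: "finite \<tau>" and ind: "\<not> affine_dependent \<tau>"
    using \<sigma> finite_simplex finite_subset simplex_indep affine_independent_subset by blast+
  have m: "m > 0" by (simp add: m_def)
  have inj: "inj_on g \<tau>" using g\<tau> fin by (simp add: eq_card_imp_inj_on)
  define pt where "pt v = (\<Sum>x\<in>\<tau>. x /\<^sub>R m) + v /\<^sub>R m" for v
  have pt: "pt v = (\<Sum>x\<in>\<tau>. ((if x = v then 2 else 1) / m) *\<^sub>R x)"
    and s: "(\<Sum>x\<in>\<tau>. ((if x = v then 2 else 1) / m)) = 1" if "v \<in> \<tau>" for v
  proof -
    have 2: "(if x = v then 2 else 1) / m = inverse m + (if x = v then inverse m else 0)" for x
      by (simp add: field_simps)
    have "(\<Sum>x\<in>\<tau>. (if x = v then inverse m else 0) *\<^sub>R x) = (\<Sum>x\<in>\<tau>. if x = v then x /\<^sub>R m else 0)"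
      by (rule sum.cong) auto
    also have "\<dots> = v /\<^sub>R m" using that fin by (simp add: sum.delta)
    finally have "(\<Sum>x\<in>\<tau>. (if x = v then inverse m else 0) *\<^sub>R x) = v /\<^sub>R m" .
    then show "pt v = (\<Sum>x\<in>\<tau>. ((if x = v then 2 else 1) / m) *\<^sub>R x)"
      unfolding pt_def 2 by (simp add: scaleR_left_distrib sum.distrib)
    show "(\<Sum>x\<in>\<tau>. ((if x = v then 2 else 1) / m)) = 1"
      unfolding 2 using that fin m by (simp add: sum.distrib sum.delta) (simp add: m_def field_simps)
  qed
  have ri: "pt v \<in> rel_interior (convex hull \<tau>)" if "v \<in> \<tau>" for v
    unfolding rel_interior_convex_hull_explicit[OF ind]
    using pt[OF that] s[OF that] m by (auto intro!: exI[of _ "\<lambda>x. (if x = v then 2 else 1) / m"])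
  have "g (pt w) = pt (g w)"
  proof -
    have gL: "g x = L x + c" if "x \<in> \<tau>" for x using g[OF hull_inc[OF that]] .
    have "(\<Sum>x\<in>\<tau>. g x /\<^sub>R m) = (\<Sum>x\<in>\<tau>. x /\<^sub>R m)"
      using sum.reindex[OF inj, of "\<lambda>x. x /\<^sub>R m"] g\<tau> by simp
    then have "pt (g w) = (\<Sum>x\<in>\<tau>. g x /\<^sub>R m) + g w /\<^sub>R m" by (simp add: pt_def)
    also have "\<dots> = (\<Sum>x\<in>\<tau>. (L x + c) /\<^sub>R m) + (L w + c) /\<^sub>R m" using w by (simp add: gL)
    \<comment> \<open>The translation part appears once for each vertex and once more for
      \<open>w\<close>, so dividing by \<open>m\<close> leaves exactly one \<open>c\<close>.\<close>
    also have "\<dots> = L (pt w) + (card \<tau> + 1) *\<^sub>R (c /\<^sub>R m)"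
      unfolding pt_def linear_add[OF L] linear_sum[OF L] linear_scale[OF L]
      by (simp add: sum.distrib sum_constant_scaleR algebra_simps)
    also have "\<dots> = L (pt w) + c" using m by (simp add: m_def)
    finally show ?thesis using g ri[OF w] rel_interior_subset by (metis subsetD)
  qed
  moreover have "quot T (g (pt w)) = quot T (pt w)"
    using q ri[OF w] rel_interior_subset by (metis subsetD)
  \<comment> \<open>Two points of the relative interior with the same class agree by
    \<open>quot_inj\<close>; cancelling the common vertex sum then compares \<open>g w\<close> with
    \<open>w\<close>.\<close>
  ultimately have "pt (g w) = pt w"
    using quot_inj[OF \<tau>] ri[OF w] ri[of "g w"] w g\<tau> by (metis image_eqI inj_onD)
  then show ?thesis using m by (simp add: pt_def)
qed

section \<open>Perspectivities\<close>

lemma perspectivity_vertex: "w \<in> \<tau> \<Longrightarrow> perspectivity T \<tau> w = pairing T \<tau> w"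
  by (simp add: perspectivity_def)

lemma perspectivity_opposite:
  "\<tau> \<in> facets T \<Longrightarrow> perspectivity T \<tau> (opposite T \<tau>) = opposite T (mate T \<tau>)"
  by (simp add: perspectivity_def opposite)

lemma perspectivity_in:
  assumes "\<tau> \<in> facets T" "w \<in> simplex_of T \<tau>"
  shows "perspectivity T \<tau> w \<in> simplex_of T (mate T \<tau>)"
  using opposite(1)[OF pairing_facet[OF assms(1)]] unfolding perspectivity_def
  by (simp add: mate_def)

lemma perspectivity_inverse:
  assumes \<tau>: "\<tau> \<in> facets T" and w: "w \<in> simplex_of T \<tau>"
  shows "perspectivity T (mate T \<tau>) (perspectivity T \<tau> w) = w"
proof (cases "w \<in> \<tau>")
  case True
  then have "pairing T \<tau> w \<in> mate T \<tau>" by (simp add: mate_def)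
  then show ?thesis using True \<tau> by (simp add: perspectivity_vertex pairing_inverse_vertex)
next
  case False
  then have "w = opposite T \<tau>" using w opposite(1)[OF \<tau>] by simp
  then show ?thesis
    using \<tau> by (simp add: perspectivity_opposite pairing_facet mate_mate)
qed

text \<open>Supplies an ordering to which \<open>pairing_orientation\<close> can be applied.\<close>

lemma positive_ordering_exists:
  assumes "\<tau> \<in> facets T"
  obtains ws where "positive T \<tau> ws" "set ws = \<tau>"
proof -
  define xs where "xs = orientation T (simplex_of T \<tau>)"
  note \<tau> = facetD[OF assms] and opp = opposite[OF assms]
  have xs: "distinct xs" "set xs = simplex_of T \<tau>"
    using orientation_ordering[OF \<tau>(1)] by (simp_all add: xs_def)
  have len: "length xs = gdim T + 1"
    using distinct_card[OF xs(1)] xs(2) simplex_card[OF \<tau>(1)] by simp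
  obtain i where i: "i < length xs" "xs ! i = opposite T \<tau>"
    using xs(2) opp(1) by (metis in_set_conv_nth insertI1)
  \<comment> \<open>Moving the opposite vertex from position \<open>i > 0\<close> to the front is an
    odd permutation; also swapping positions 1 and 2, which leaves 0 alone, makes it even.\<close>
  define q where "q = (if i = 0 then id else Transposition.transpose 0 i \<circ> Transposition.transpose 1 2)"
  have q: "q permutes {..<length xs}" "evenperm q" "q 0 = i"
    using i(1) len dim_ge_2
    by (auto simp: q_def permutes_id evenperm_comp evenperm_swap permutation_swap_id
        Transposition.transpose_def evenperm_id intro!: permutes_compose permutes_swap_id)
  define ys where "ys = permute_list q xs"
  have ys: "ys ! 0 = opposite T \<tau>" "length ys = length xs" "distinct ys" "set ys = simplex_of T \<tau>"
    using q i len xs by (simp_all add: ys_def permute_list_nth set_permute_list distinct_permute_list)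
  then have hd: "ys = opposite T \<tau> # tl ys"
    using len by (cases ys) auto
  have "positive T \<tau> (tl ys)"
    unfolding positive_def hd[symmetric] using q len by (auto simp: ys_def xs_def)
  moreover have "set (tl ys) = \<tau>"
    using ys(3,4) opp hd by (metis distinct.simps(2) insert_ident list.simps(15))
  ultimately show ?thesis using that by blast
qed

text \<open>By \<open>self_gluing_trivial\<close>, a facet paired with itself would be glued by the
  identity on its vertices, which preserves orientation instead of reversing it.\<close>

lemma mate_neq:
  assumes \<tau>: "\<tau> \<in> facets T"
  shows "mate T \<tau> \<noteq> \<tau>"
proof
  assume eq: "mate T \<tau> = \<tau>"
  obtain L c where L: "linear L" and c: "\<forall>x\<in>convex hull \<tau>. pairing T \<tau> x = L x + c"
    using pairing_affine[OF \<tau>] by auto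
  have "pairing T \<tau> w = w" if w: "w \<in> \<tau>" for w
  proof (rule self_gluing_trivial[OF _ _ L _ _ _ w])
    show "\<tau> \<in> faces T (gdim T - 1)" using \<tau> by (simp add: facets_def)
    show "pairing T \<tau> x = L x + c" if "x \<in> convex hull \<tau>" for x using c that by (rule bspec)
    show "pairing T \<tau> ` \<tau> = \<tau>" using eq by (simp add: mate_def)
    show "quot T (pairing T \<tau> x) = quot T x" if "x \<in> convex hull \<tau>" for x
      using \<tau> that by (rule quot_pairing)
  qed simp
  then have id: "map (pairing T \<tau>) ws = ws" if "set ws = \<tau>" for ws
    using that by (intro map_idI) simp
  obtain ws where "positive T \<tau> ws" "set ws = \<tau>" using positive_ordering_exists[OF \<tau>] .
  then show False using pairing_orientation[OF \<tau>, of ws] id[of ws] eq by simp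
qed

section \<open>Flags and the degree of a codimension-two singlex\<close>

text \<open>Normal form for flags: \<open>x\<close> and \<open>y\<close> are the two vertices of the
  simplex off \<open>\<rho>\<close>, and adding one of them to \<open>\<rho>\<close> gives the facet
  opposite the other.\<close>

lemma flagE:
  assumes "f \<in> flags T"
  obtains \<rho> y x where "f = (\<rho>, insert y \<rho>)" "insert y \<rho> \<in> facets T" "insert x \<rho> \<in> facets T"
    "y \<notin> \<rho>" "x \<notin> \<rho>" "x \<noteq> y" "card \<rho> + 1 = gdim T" "\<rho> \<noteq> {}"
    "simplex_of T (insert y \<rho>) = insert x (insert y \<rho>)"
    "simplex_of T (insert x \<rho>) = insert x (insert y \<rho>)"
    "opposite T (insert y \<rho>) = x" "opposite T (insert x \<rho>) = y"
proof -
  obtain \<rho> \<tau> where f: "f = (\<rho>, \<tau>)" and \<tau>: "\<tau> \<in> facets T" "\<rho> \<subseteq> \<tau>" and c: "card \<rho> + 1 = gdim T"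
    using assms by (auto simp: flags_def)
  note \<tau>' = facetD[OF \<tau>(1)] and opp = opposite[OF \<tau>(1)]
  have fin: "finite \<rho>" using \<tau>(2) \<tau>'(4) by (rule finite_subset)
  have ne: "\<rho> \<noteq> {}" using c dim_ge_2 by auto
  have "card (\<tau> - \<rho>) = 1" using \<tau>(2) \<tau>'(3) c fin by (simp add: card_Diff_subset)
  then obtain y where "\<tau> - \<rho> = {y}" by (rule card_1_singletonE)
  then have y: "\<tau> = insert y \<rho>" "y \<notin> \<rho>" using \<tau>(2) by auto
  obtain x where x: "simplex_of T \<tau> = insert x \<tau>" "x \<notin> \<tau>" "opposite T \<tau> = x" using opp by simp
  have \<tau>x: "insert x \<rho> \<in> facets T"
    by (rule facetI[OF \<tau>'(1)]) (use x y c fin in auto)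
  have "opposite T (insert x \<rho>) = y"
    by (rule opposite_eq[OF \<tau>'(1)]) (use x y in auto)
  moreover have "simplex_of T (insert x \<rho>) = simplex_of T \<tau>"
    by (rule simplex_of_eq[OF \<tau>'(1)]) (use x y in auto)
  ultimately show ?thesis
    by (intro that[of \<rho> y x]) (use f \<tau>(1) \<tau>x y x c ne in simp_all)
qed

text \<open>The nonempty face \<open>\<rho>\<close> lies in only one simplex, which has just two
  further vertices that could complete \<open>\<rho>\<close> to a facet.\<close>

lemma facet_containing_flag:
  assumes "(\<rho>, \<tau>) \<in> flags T" "\<tau>' \<in> facets T" "\<rho> \<subseteq> \<tau>'"
  shows "(\<rho>, \<tau>') = (\<rho>, \<tau>) \<or> (\<rho>, \<tau>') = flip T (\<rho>, \<tau>)"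
proof -
  obtain \<rho>' y x where "(\<rho>, \<tau>) = (\<rho>', insert y \<rho>')" "insert y \<rho>' \<in> facets T" "\<rho>' \<noteq> {}"
    "simplex_of T (insert y \<rho>') = insert x (insert y \<rho>')" "opposite T (insert y \<rho>') = x"
    using assms(1) by (rule flagE)
  then have f: "\<tau> = insert y \<rho>" "\<tau> \<in> facets T" "\<rho> \<noteq> {}"
    "simplex_of T \<tau> = insert x (insert y \<rho>)" "opposite T \<tau> = x" by simp_all
  have "(\<rho>, \<tau>') \<in> flags T" using assms by (auto simp: flags_def)
  then obtain \<rho>'' z where "(\<rho>, \<tau>') = (\<rho>'', insert z \<rho>'')" "z \<notin> \<rho>''" by (rule flagE)
  then have z: "\<tau>' = insert z \<rho>" "z \<notin> \<rho>" by simp_all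
  have "simplex_of T \<rho> = simplex_of T \<tau>"
    by (rule simplex_of_eq[OF facetD(1)[OF f(2)] _ f(3)]) (use f(4) in auto)
  moreover have "simplex_of T \<rho> = simplex_of T \<tau>'"
    using assms(3) facetD(2)[OF assms(2)] by (intro simplex_of_eq[OF facetD(1)[OF assms(2)] _ f(3)]) (rule subset_trans)
  ultimately have "z \<in> insert x (insert y \<rho>)" using facetD(2)[OF assms(2)] f(4) z by auto
  then show ?thesis using z f by (auto simp: flip_def)
qed

lemma flip:
  assumes "f \<in> flags T"
  shows "flip T f \<in> flags T \<and> flip T (flip T f) = f \<and> flip T f \<noteq> f"
proof -
  obtain \<rho> y x where f: "f = (\<rho>, insert y \<rho>)" and x: "insert x \<rho> \<in> facets T" "x \<notin> \<rho>" "x \<noteq> y"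
    "card \<rho> + 1 = gdim T" "opposite T (insert y \<rho>) = x" "opposite T (insert x \<rho>) = y"
    using assms by (rule flagE)
  have "insert x \<rho> \<noteq> insert y \<rho>" using x(2,3) by (metis insertE insertI1)
  then show ?thesis using f x by (simp add: flip_def flags_def subset_insertI)
qed

lemma cross:
  assumes "f \<in> flags T"
  shows "cross T f \<in> flags T \<and> cross T (cross T f) = f \<and> cross T f \<noteq> f"
proof -
  obtain \<rho> \<tau> where f: "f = (\<rho>, \<tau>)" and \<tau>: "\<tau> \<in> facets T" "\<rho> \<subseteq> \<tau>" and c: "card \<rho> + 1 = gdim T"
    using assms by (auto simp: flags_def)
  have "card (pairing T \<tau> ` \<rho>) = card \<rho>"
    using \<tau> by (intro card_image inj_on_subset[OF inj_on_pairing])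
  then have "cross T f \<in> flags T"
    using f \<tau> c pairing_facet[OF \<tau>(1)] by (auto simp: flags_def cross_def mate_def)
  moreover have "(\<lambda>v. pairing T (mate T \<tau>) (pairing T \<tau> v)) ` \<rho> = \<rho>"
    using \<tau> pairing_inverse_vertex[OF \<tau>(1)] by (simp add: subset_iff)
  then have "cross T (cross T f) = f"
    by (simp add: f cross_def mate_mate[OF \<tau>(1)] image_image)
  moreover have "cross T f \<noteq> f" using mate_neq[OF \<tau>(1)] by (simp add: f cross_def)
  ultimately show ?thesis by blast
qed

text \<open>The definite description in \<open>turn\<close> has a unique solution because exactly
  two facets pass through the image face, \<open>mate T \<tau>\<close> and its flip.\<close>

lemma turn_eq:
  assumes "f \<in> flags T"
  shows "turn T f = flip T (cross T f)"
proof -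
  obtain \<rho> \<tau> where f: "f = (\<rho>, \<tau>)" by (cases f)
  have g: "(pairing T \<tau> ` \<rho>, mate T \<tau>) \<in> flags T"
    using cross[OF assms] by (simp add: f cross_def)
  let ?\<tau>' = "insert (opposite T (mate T \<tau>)) (pairing T \<tau> ` \<rho>)"
  have "(THE \<tau>'. \<tau>' \<in> facets T \<and> pairing T \<tau> ` \<rho> \<subseteq> \<tau>' \<and> \<tau>' \<noteq> mate T \<tau>) = ?\<tau>'"
  proof (rule the_equality)
    show "?\<tau>' \<in> facets T \<and> pairing T \<tau> ` \<rho> \<subseteq> ?\<tau>' \<and> ?\<tau>' \<noteq> mate T \<tau>"
      using flip[OF g] by (auto simp: flip_def flags_def)
    show "\<tau>' = ?\<tau>'" if "\<tau>' \<in> facets T \<and> pairing T \<tau> ` \<rho> \<subseteq> \<tau>' \<and> \<tau>' \<noteq> mate T \<tau>" for \<tau>'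
      using facet_containing_flag[OF g] that by (auto simp: flip_def)
  qed
  then show ?thesis by (simp add: f turn_def cross_def flip_def)
qed

lemma fst_turn: "fst (turn T f) = pairing T (snd f) ` fst f"
  by (simp add: turn_def case_prod_beta)

lemma turn_in_flags: "f \<in> flags T \<Longrightarrow> turn T f \<in> flags T"
  using cross flip by (simp add: turn_eq)

lemma funpow_turn_in_flags: "f \<in> flags T \<Longrightarrow> (turn T ^^ j) f \<in> flags T"
  by (induction j) (simp_all add: turn_in_flags)

text \<open>Undoing the two involutions in reverse order inverts a turn; this yields injectivity and
  later the predecessor of a flag.\<close>

lemma cross_flip_turn: "f \<in> flags T \<Longrightarrow> cross T (flip T (turn T f)) = f"
  using cross[of f] flip[of "cross T f"] by (simp add: turn_eq)

lemma funpow_turn_neq_flip: "f \<in> flags T \<Longrightarrow> (turn T ^^ j) f \<noteq> flip T f"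
  by (rule funpow_comp_involutions_neq[OF flip cross turn_eq])

lemma funpow_turn_inj:
  assumes "f \<in> flags T" "g \<in> flags T" "(turn T ^^ j) f = (turn T ^^ j) g"
  shows "f = g"
  using assms(3)
proof (induction j)
  case (Suc j)
  then have "turn T ((turn T ^^ j) f) = turn T ((turn T ^^ j) g)" by simp
  then have "cross T (flip T (turn T ((turn T ^^ j) f))) = cross T (flip T (turn T ((turn T ^^ j) g)))"
    by (rule arg_cong)
  then have "(turn T ^^ j) f = (turn T ^^ j) g"
    unfolding cross_flip_turn[OF funpow_turn_in_flags[OF assms(1)]]
      cross_flip_turn[OF funpow_turn_in_flags[OF assms(2)]] .
  then show ?case by (rule Suc.IH)
qed simp

lemma flags_subset: "flags T \<subseteq> Pow (\<Union>(simplices T)) \<times> Pow (\<Union>(simplices T))"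
proof
  fix f assume "f \<in> flags T"
  then obtain \<rho> \<tau> where f: "f = (\<rho>, \<tau>)" "\<tau> \<in> facets T" "\<rho> \<subseteq> \<tau>" by (auto simp: flags_def)
  have "\<tau> \<subseteq> \<Union>(simplices T)" 
    using subset_trans[OF facetD(2)[OF f(2)] Union_upper[OF facetD(1)[OF f(2)]]] .
  then show "f \<in> Pow (\<Union>(simplices T)) \<times> Pow (\<Union>(simplices T))"
    using subset_trans[OF f(3)] by (simp add: f(1))
qed

lemma finite_flags: "finite (flags T)"
  by (rule finite_subset[OF flags_subset]) (simp add: finite_simplices finite_simplex)

text \<open>There are finitely many flags, so some power of the turn repeats, and injectivity
  cancels the common initial turns.\<close>

lemma turn_period:
  assumes f: "f \<in> flags T"
  shows "0 < turn_period T f" "(turn T ^^ turn_period T f) f = f"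
proof -
  have "\<not> inj (\<lambda>j. (turn T ^^ j) f)"
  proof
    assume "inj (\<lambda>j. (turn T ^^ j) f)"
    moreover have "finite (range (\<lambda>j. (turn T ^^ j) f))"
      by (rule finite_subset[OF _ finite_flags]) (use funpow_turn_in_flags[OF f] in auto)
    ultimately show False using finite_imageD infinite_UNIV_nat by blast
  qed
  then obtain i j where ij: "i \<noteq> j" "(turn T ^^ i) f = (turn T ^^ j) f"
    unfolding inj_def by blast
  have *: "\<exists>d>0. (turn T ^^ d) f = f" if "i < j" "(turn T ^^ i) f = (turn T ^^ j) f" for i j
  proof -
    have "(turn T ^^ j) f = (turn T ^^ i) ((turn T ^^ (j - i)) f)"
      using that(1) funpow_add_apply[of i "j - i" "turn T" f] by simp
    then have "f = (turn T ^^ (j - i)) f"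
      using that(2) by (intro funpow_turn_inj[OF f funpow_turn_in_flags[OF f], of i]) simp
    then show ?thesis using that(1) by (intro exI[of _ "j - i"]) simp
  qed
  have "\<exists>d>0. (turn T ^^ d) f = f"
    using *[of i j] *[of j i] ij by (cases "i < j") simp_all
  then have "0 < turn_period T f \<and> (turn T ^^ turn_period T f) f = f"
    unfolding turn_period_def by (rule LeastI_ex)
  then show "0 < turn_period T f" "(turn T ^^ turn_period T f) f = f" by simp_all
qed

lemma turn_period_le: "0 < d \<Longrightarrow> (turn T ^^ d) f = f \<Longrightarrow> turn_period T f \<le> d"
  unfolding turn_period_def by (rule Least_le) simp

lemma funpow_turn_mod:
  assumes "f \<in> flags T"
  shows "(turn T ^^ (j mod turn_period T f)) f = (turn T ^^ j) f"
  using turn_period(2)[OF assms] by (rule funpow_mod_eq)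

text \<open>A face met a second time would come back either with the same facet, before the period
  has elapsed, or with the other one, which the dihedral relations of \<open>flip\<close> and \<open>cross\<close> exclude.\<close>

lemma inj_on_fst_turn:
  assumes f: "f \<in> flags T"
  shows "inj_on (\<lambda>j. fst ((turn T ^^ j) f)) {..<turn_period T f}"
proof (rule linorder_inj_onI')
  fix i j assume ij: "i \<in> {..<turn_period T f}" "j \<in> {..<turn_period T f}" "i < j"
  let ?g = "(turn T ^^ i) f" and ?h = "(turn T ^^ j) f"
  have g: "?g \<in> flags T" and h: "?h \<in> flags T" using f by (simp_all add: funpow_turn_in_flags)
  have hg: "?h = (turn T ^^ (j - i)) ?g" "?h = (turn T ^^ i) ((turn T ^^ (j - i)) f)"
    using ij(3) funpow_add_apply[of "j - i" i "turn T" f] funpow_add_apply[of i "j - i" "turn T" f]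
    by simp_all
  show "fst ?g \<noteq> fst ?h"
  proof
    assume "fst ?g = fst ?h"
    moreover obtain \<rho> \<tau> where g\<rho>: "?g = (\<rho>, \<tau>)" by fastforce
    moreover obtain \<rho>' \<tau>' where h\<rho>: "?h = (\<rho>', \<tau>')" by fastforce
    ultimately have "\<rho>' = \<rho>" by simp
    then have "?h = ?g \<or> ?h = flip T ?g"
      using facet_containing_flag[of \<rho> \<tau> \<tau>'] g h unfolding g\<rho> h\<rho> by (simp add: flags_def)
    then have "?h = ?g" using funpow_turn_neq_flip[OF g] hg(1) by metis
    then have "f = (turn T ^^ (j - i)) f"
      using hg(2) by (intro funpow_turn_inj[OF f funpow_turn_in_flags[OF f], of i]) simp
    then have "turn_period T f \<le> j - i" using ij(3) by (intro turn_period_le) simp_all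
    then show False using ij by simp
  qed
qed

text \<open>The faces of a turn orbit are closed under all pairings: one of the two facets through
  such a face leads to the next face, the other back to the previous one.\<close>

lemma pairing_fst_turn:
  assumes f: "f \<in> flags T" and \<tau>: "\<tau> \<in> facets T" "fst ((turn T ^^ j) f) \<subseteq> \<tau>"
  shows "\<exists>k. pairing T \<tau> ` fst ((turn T ^^ j) f) = fst ((turn T ^^ k) f)"
proof -
  let ?g = "(turn T ^^ j) f"
  obtain \<rho> \<tau>' where g\<rho>: "?g = (\<rho>, \<tau>')" by fastforce
  have g: "?g \<in> flags T" using f by (rule funpow_turn_in_flags)
  consider "(\<rho>, \<tau>) = ?g" | "(\<rho>, \<tau>) = flip T ?g"
    using facet_containing_flag[of \<rho> \<tau>' \<tau>] g \<tau> unfolding g\<rho> by auto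
  then show ?thesis
  proof cases
    case 1
    then have "snd ?g = \<tau>" unfolding g\<rho> by simp
    then show ?thesis by (intro exI[of _ "Suc j"]) (simp add: fst_turn)
  next
    case 2
    \<comment> \<open>The predecessor of step \<open>j\<close>, taken one period later so that
      \<open>j = 0\<close> is covered as well.\<close>
    let ?h = "(turn T ^^ (j + turn_period T f - 1)) f"
    have "turn T ?h = (turn T ^^ Suc (j + turn_period T f - 1)) f" by (simp only: funpow.simps comp_apply)
    also have "\<dots> = (turn T ^^ j) ((turn T ^^ turn_period T f) f)"
      unfolding funpow_add_apply[symmetric] using turn_period(1)[OF f] by simp
    finally have h: "turn T ?h = ?g" unfolding turn_period(2)[OF f] .
    have "cross T (flip T (turn T ?h)) = ?h" by (rule cross_flip_turn[OF funpow_turn_in_flags[OF f]])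
    then have "cross T (\<rho>, \<tau>) = ?h" unfolding h 2 .
    then have "fst (cross T (\<rho>, \<tau>)) = fst ?h" by (rule arg_cong)
    then have "pairing T \<tau> ` fst ?g = fst ?h" unfolding g\<rho> by (simp add: cross_def)
    then show ?thesis by (rule exI)
  qed
qed

lemma face_subset_if_meets:
  assumes "\<sigma> \<in> simplices T" "\<sigma>' \<in> simplices T" "\<rho> \<subseteq> \<sigma>" "\<tau> \<subseteq> \<sigma>'"
    and x: "x \<in> rel_interior (convex hull \<rho>)" "x \<in> convex hull \<tau>"
  shows "\<rho> \<subseteq> \<tau>"
proof -
  have "x \<in> convex hull \<sigma>"
    using subsetD[OF hull_mono[OF assms(3)] subsetD[OF rel_interior_subset x(1)]] .
  moreover have "x \<in> convex hull \<sigma>'" using subsetD[OF hull_mono[OF assms(4)] x(2)] .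
  ultimately have "\<sigma> = \<sigma>'" using simplices_disjoint[OF assms(1,2)] by auto
  then show ?thesis using assms simplex_indep by (intro subset_if_rel_interior_meets[OF _ _ _ x]) simp_all
qed

text \<open>A facet whose hull meets the relative interior of a face contains that face, so each
  pairing in the chain carries the whole face along, and the image is again in the orbit.\<close>

lemma glue_rel_interior_orbit:
  assumes f: "f \<in> flags T" and x: "x \<in> rel_interior (convex hull (fst f))" and xy: "(x, y) \<in> (glue T)\<^sup>*"
  shows "\<exists>k. y \<in> rel_interior (convex hull (fst ((turn T ^^ k) f)))"
  using xy
proof (induction rule: rtrancl_induct)
  case base
  show ?case using x by (intro exI[of _ 0]) simp
next
  case (step y z)
  then obtain k where y: "y \<in> rel_interior (convex hull (fst ((turn T ^^ k) f)))" by blast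
  obtain \<tau> where \<tau>: "\<tau> \<in> facets T" "y \<in> convex hull \<tau>" "z = pairing T \<tau> y"
    using step.hyps(2) by (auto simp: glue_def)
  let ?g = "(turn T ^^ k) f"
  have g: "snd ?g \<in> facets T" "fst ?g \<subseteq> snd ?g"
    using funpow_turn_in_flags[OF f, of k] by (simp_all add: flags_def case_prod_beta)
  have sub: "fst ?g \<subseteq> \<tau>"
    by (rule face_subset_if_meets[OF facetD(1)[OF g(1)] facetD(1)[OF \<tau>(1)]
          subset_trans[OF g(2) facetD(2)[OF g(1)]] facetD(2)[OF \<tau>(1)] y \<tau>(2)])
  have "z \<in> rel_interior (convex hull (pairing T \<tau> ` fst ?g))"
    unfolding \<tau>(3) pairing_hull(2)[OF \<tau>(1) sub, symmetric] using y by (intro imageI)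
  moreover obtain k' where "pairing T \<tau> ` fst ?g = fst ((turn T ^^ k') f)"
    using pairing_fst_turn[OF f \<tau>(1) sub] by (rule exE)
  ultimately show ?case by (intro exI[of _ k']) (simp only:)
qed

lemma singlex_fst_turn:
  assumes "f \<in> flags T"
  shows "singlex T (fst ((turn T ^^ j) f)) = singlex T (fst f)"
proof (induction j)
  case (Suc j)
  let ?g = "(turn T ^^ j) f"
  have g: "snd ?g \<in> facets T" "fst ?g \<subseteq> snd ?g"
    using funpow_turn_in_flags[OF assms, of j] by (simp_all add: flags_def case_prod_beta)
  have "singlex T (fst (turn T ?g)) = (\<lambda>x. quot T (pairing T (snd ?g) x)) ` (convex hull (fst ?g))"
    unfolding singlex_def fst_turn pairing_hull(1)[OF g, symmetric] by (rule image_image)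
  also have "\<dots> = singlex T (fst ?g)"
    unfolding singlex_def
    by (rule image_cong[OF refl]) (rule quot_pairing[OF g(1) subsetD[OF hull_mono[OF g(2)]]])
  finally show ?case using Suc.IH by simp
qed simp

lemma codim2_face_iff:
  "\<rho> \<in> faces T (gdim T - 2) \<longleftrightarrow> (\<exists>\<sigma>\<in>simplices T. \<rho> \<subseteq> \<sigma>) \<and> card \<rho> + 1 = gdim T"
  using dim_ge_2 by (auto simp: faces_def)

lemma fst_flag_face:
  assumes "f \<in> flags T"
  shows "fst f \<in> faces T (gdim T - 2)"
proof -
  have f: "snd f \<in> facets T" "fst f \<subseteq> snd f" "card (fst f) + 1 = gdim T"
    using assms by (simp_all add: flags_def case_prod_beta)
  then show ?thesis
    using facetD(1)[OF f(1)] subset_trans[OF f(2) facetD(2)[OF f(1)]] codim2_face_iff by blast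
qed

text \<open>The faces over the singlex are exactly the faces met during one period. An interior
  point of \<open>fst f\<close> is identified with a point of any such \<open>\<rho>\<close>, which
  places that point inside a face of the orbit; \<open>inj_on_fst_turn\<close> then does the
  counting.\<close>

lemma singlex_degree_eq_turn_period:
  assumes f: "f \<in> flags T"
  shows "singlex_degree T (gdim T - 2) (singlex T (fst f)) = turn_period T f"
proof -
  let ?A = "{\<rho> \<in> faces T (gdim T - 2). singlex T \<rho> = singlex T (fst f)}"
  have "?A = (\<lambda>j. fst ((turn T ^^ j) f)) ` {..<turn_period T f}"
  proof
    show "(\<lambda>j. fst ((turn T ^^ j) f)) ` {..<turn_period T f} \<subseteq> ?A"
      using fst_flag_face[OF funpow_turn_in_flags[OF f]] singlex_fst_turn[OF f]
      by (intro image_subsetI CollectI conjI)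
    show "?A \<subseteq> (\<lambda>j. fst ((turn T ^^ j) f)) ` {..<turn_period T f}"
    proof
      fix \<rho> assume "\<rho> \<in> ?A"
      then have "\<rho> \<in> faces T (gdim T - 2)" and eq: "singlex T \<rho> = singlex T (fst f)" by simp_all
      then obtain \<sigma> where \<sigma>: "\<sigma> \<in> simplices T" "\<rho> \<subseteq> \<sigma>" and c: "card \<rho> + 1 = gdim T"
        unfolding codim2_face_iff by blast
      have "fst f \<noteq> {}" using f dim_ge_2 by (auto simp: flags_def)
      then have "rel_interior (convex hull (fst f)) \<noteq> {}"
        by (simp add: rel_interior_eq_empty)
      then obtain x where x: "x \<in> rel_interior (convex hull (fst f))" by blast
      then have "quot T x \<in> singlex T \<rho>"
        unfolding eq unfolding singlex_def by (rule imageI[OF subsetD[OF rel_interior_subset]])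
      then obtain y where y: "y \<in> convex hull \<rho>" "quot T x = quot T y"
        unfolding singlex_def by blast
      obtain k where k: "y \<in> rel_interior (convex hull (fst ((turn T ^^ k) f)))"
        using glue_rel_interior_orbit[OF f x iffD1[OF quot_eq_iff y(2)]] by blast
      let ?g = "(turn T ^^ k) f"
      have "fst ?g \<in> faces T (gdim T - 2)" using f by (intro fst_flag_face funpow_turn_in_flags)
      then obtain \<sigma>' where \<sigma>': "\<sigma>' \<in> simplices T" "fst ?g \<subseteq> \<sigma>'" and c': "card (fst ?g) + 1 = gdim T"
        unfolding codim2_face_iff by blast
      \<comment> \<open>The point \<open>y\<close> might a priori lie on the boundary of
        \<open>\<rho>\<close>; it is interior to \<open>fst ?g\<close>, so inclusion holds in this
        direction and equal cardinality gives equality.\<close>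
      have "fst ?g \<subseteq> \<rho>" by (rule face_subset_if_meets[OF \<sigma>'(1) \<sigma>(1) \<sigma>'(2) \<sigma>(2) k y(1)])
      moreover have "finite \<rho>" using \<sigma>(2) finite_simplex[OF \<sigma>(1)] by (rule finite_subset)
      ultimately have "fst ?g = \<rho>" using c c' by (intro card_subset_eq) simp_all
      then have "\<rho> = fst ((turn T ^^ (k mod turn_period T f)) f)"
        by (simp only: funpow_turn_mod[OF f])
      then show "\<rho> \<in> (\<lambda>j. fst ((turn T ^^ j) f)) ` {..<turn_period T f}"
        using turn_period(1)[OF f] by (intro image_eqI[of _ _ "k mod turn_period T f"]) simp_all
    qed
  qed
  then show ?thesis
    unfolding singlex_degree_def by (simp only: card_image[OF inj_on_fst_turn[OF f]] card_lessThan)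
qed

lemma flag_of_face:
  assumes "\<rho> \<in> faces T (gdim T - 2)"
  obtains \<tau> where "(\<rho>, \<tau>) \<in> flags T"
proof -
  obtain \<sigma> where \<sigma>: "\<sigma> \<in> simplices T" "\<rho> \<subseteq> \<sigma>" and c: "card \<rho> + 1 = gdim T"
    using assms unfolding codim2_face_iff by blast
  have fin: "finite \<rho>" using \<sigma>(2) finite_simplex[OF \<sigma>(1)] by (rule finite_subset)
  have "\<rho> \<noteq> \<sigma>" using simplex_card[OF \<sigma>(1)] c by auto
  then obtain y where y: "y \<in> \<sigma>" "y \<notin> \<rho>" using \<sigma>(2) by auto
  have "insert y \<rho> \<in> facets T"
    by (rule facetI[OF \<sigma>(1)]) (use y \<sigma>(2) c fin in simp_all)
  then show ?thesis using c by (intro that[of "insert y \<rho>"]) (simp add: flags_def subset_insertI)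
qed

lemma even_triangulation_iff: "even_triangulation T \<longleftrightarrow> (\<forall>f\<in>flags T. even (turn_period T f))"
proof
  assume even: "even_triangulation T"
  show "\<forall>f\<in>flags T. even (turn_period T f)"
  proof
    fix f assume f: "f \<in> flags T"
    then show "even (turn_period T f)"
      using even fst_flag_face[OF f] singlex_degree_eq_turn_period[OF f]
      unfolding even_triangulation_def by metis
  qed
next
  assume even: "\<forall>f\<in>flags T. even (turn_period T f)"
  show "even_triangulation T"
    unfolding even_triangulation_def
  proof
    fix \<rho> assume "\<rho> \<in> faces T (gdim T - 2)"
    then obtain \<tau> where f: "(\<rho>, \<tau>) \<in> flags T" by (rule flag_of_face)
    show "even (singlex_degree T (gdim T - 2) (singlex T \<rho>))"
      using singlex_degree_eq_turn_period[OF f] bspec[OF even f] by simp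
  qed
qed

section \<open>Projectivities along dual paths\<close>

lemma simplex_of_facet:
  assumes "\<tau> \<in> facets T" "\<tau> \<subseteq> \<sigma>" "\<sigma> \<in> simplices T"
  shows "simplex_of T \<tau> = \<sigma>"
  using assms facetD(5)[OF assms(1)] by (intro simplex_of_eq)

lemma bij_betw_perspectivity:
  assumes \<tau>: "\<tau> \<in> facets T"
  shows "bij_betw (perspectivity T \<tau>) (simplex_of T \<tau>) (simplex_of T (mate T \<tau>))"
proof (rule bij_betw_byWitness[where f' = "perspectivity T (mate T \<tau>)"])
  note \<tau>' = pairing_facet[OF \<tau>]
  show "\<forall>w\<in>simplex_of T \<tau>. perspectivity T (mate T \<tau>) (perspectivity T \<tau> w) = w"
    using perspectivity_inverse[OF \<tau>] by (rule ballI)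
  show "\<forall>w\<in>simplex_of T (mate T \<tau>). perspectivity T \<tau> (perspectivity T (mate T \<tau>) w) = w"
    using perspectivity_inverse[OF \<tau>'] unfolding mate_mate[OF \<tau>] by (rule ballI)
  show "perspectivity T \<tau> ` simplex_of T \<tau> \<subseteq> simplex_of T (mate T \<tau>)"
    using perspectivity_in[OF \<tau>] by (rule image_subsetI)
  show "perspectivity T (mate T \<tau>) ` simplex_of T (mate T \<tau>) \<subseteq> simplex_of T \<tau>"
    using perspectivity_in[OF \<tau>'] unfolding mate_mate[OF \<tau>] by (rule image_subsetI)
qed

lemma dual_path_append:
  "dual_path T \<sigma> (u @ v) \<sigma>' \<longleftrightarrow> (\<exists>\<sigma>1. dual_path T \<sigma> u \<sigma>1 \<and> dual_path T \<sigma>1 v \<sigma>')"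
  by (induction u arbitrary: \<sigma>) auto

lemma dual_path_simplex:
  "dual_path T \<sigma> \<gamma> \<sigma>' \<Longrightarrow> \<sigma> \<in> simplices T \<Longrightarrow> \<sigma>' \<in> simplices T"
  by (induction \<gamma> arbitrary: \<sigma>) (auto simp: facetD(1) pairing_facet)

lemma dual_path_unique:
  "dual_path T \<sigma> \<gamma> \<sigma>' \<Longrightarrow> dual_path T \<sigma> \<gamma> \<sigma>'' \<Longrightarrow> \<sigma>' = \<sigma>''"
  by (induction \<gamma> arbitrary: \<sigma>) auto

lemma bij_betw_fold_perspectivity:
  "dual_path T \<sigma> \<gamma> \<sigma>' \<Longrightarrow> \<sigma> \<in> simplices T \<Longrightarrow> bij_betw (fold (perspectivity T) \<gamma>) \<sigma> \<sigma>'"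
proof (induction \<gamma> arbitrary: \<sigma>)
  case Nil
  then show ?case by (simp add: bij_betw_def)
next
  case (Cons \<tau> \<gamma>)
  then have \<tau>: "\<tau> \<in> facets T" "simplex_of T \<tau> = \<sigma>" by (simp_all add: simplex_of_facet)
  have "bij_betw (fold (perspectivity T) \<gamma>) (simplex_of T (mate T \<tau>)) \<sigma>'"
    using Cons.prems(1) \<tau> by (intro Cons.IH) (simp_all add: facetD(1) pairing_facet)
  with bij_betw_perspectivity[OF \<tau>(1)] show ?case
    unfolding \<tau>(2) fold_Cons by (rule bij_betw_trans)
qed

lemma dual_path_back_and_forth:
  assumes "dual_path T \<sigma> [\<tau>, mate T \<tau>] \<sigma>'" "\<sigma> \<in> simplices T"
  shows "\<sigma>' = \<sigma>" "w \<in> \<sigma> \<Longrightarrow> fold (perspectivity T) [\<tau>, mate T \<tau>] w = w"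
proof -
  have \<tau>: "\<tau> \<in> facets T" "simplex_of T \<tau> = \<sigma>" using assms by (simp_all add: simplex_of_facet)
  show "\<sigma>' = \<sigma>" using assms(1) \<tau> by (simp add: mate_mate)
  show "fold (perspectivity T) [\<tau>, mate T \<tau>] w = w" if "w \<in> \<sigma>"
    using perspectivity_inverse[OF \<tau>(1)] that \<tau>(2) by simp
qed

lemma turn_path_simps [simp]:
  "turn_path T f 0 = []"
  "turn_path T f (Suc k) = turn_path T f k @ [snd ((turn T ^^ k) f)]"
  by (simp_all add: turn_path_def)

lemma cell_boundaries_eq: "cell_boundaries T = (\<lambda>f. turn_path T f (turn_period T f)) ` flags T"
proof -
  have "\<rho> \<in> faces T (gdim T - 2) \<and> \<tau> \<in> facets T \<and> \<rho> \<subseteq> \<tau> \<longleftrightarrow> (\<rho>, \<tau>) \<in> flags T" for \<rho> \<tau>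
    using fst_flag_face[of "(\<rho>, \<tau>)"] by (auto simp: flags_def codim2_face_iff)
  then show ?thesis unfolding cell_boundaries_def turn_path_def by auto
qed

lemma simplex_of_flip:
  assumes "f \<in> flags T"
  shows "simplex_of T (snd (flip T f)) = simplex_of T (snd f)"
proof -
  obtain \<rho> y x where "f = (\<rho>, insert y \<rho>)"
    "simplex_of T (insert y \<rho>) = insert x (insert y \<rho>)"
    "simplex_of T (insert x \<rho>) = insert x (insert y \<rho>)" "opposite T (insert y \<rho>) = x"
    using assms by (rule flagE)
  then show ?thesis by (simp add: flip_def)
qed

lemma opposite_flip:
  assumes "(\<rho>, insert y \<rho>) \<in> flags T" "y \<notin> \<rho>"
  shows "opposite T (snd (flip T (\<rho>, insert y \<rho>))) = y"
proof -
  obtain \<rho>' y' x where *: "(\<rho>, insert y \<rho>) = (\<rho>', insert y' \<rho>')" "y' \<notin> \<rho>'"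
    "opposite T (insert y' \<rho>') = x" "opposite T (insert x \<rho>') = y'"
    using assms(1) by (rule flagE)
  then have "\<rho>' = \<rho>" by simp
  moreover from this have "y' = y" using * assms(2) by (simp add: insert_ident) (metis insertE insertI1)
  ultimately show ?thesis using *(3,4) by (simp add: flip_def)
qed

text \<open>The two vertices off the face are named by the facets opposite to them, which lets a
  turn act on the names.\<close>

lemma simplex_of_flag:
  assumes "f \<in> flags T"
  shows "simplex_of T (snd f) = fst f \<union> {opposite T (snd f), opposite T (snd (flip T f))}"
    and "opposite T (snd f) \<noteq> opposite T (snd (flip T f))"
proof -
  obtain \<rho> y x where *: "f = (\<rho>, insert y \<rho>)" "x \<noteq> y"
    "simplex_of T (insert y \<rho>) = insert x (insert y \<rho>)"
    "opposite T (insert y \<rho>) = x" "opposite T (insert x \<rho>) = y"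
    using assms by (rule flagE)
  then show "simplex_of T (snd f) = fst f \<union> {opposite T (snd f), opposite T (snd (flip T f))}"
    "opposite T (snd f) \<noteq> opposite T (snd (flip T f))"
    by (auto simp: flip_def)
qed

text \<open>The facet of entry is the flip of the next facet of exit. Hence the vertex opposite the
  facet of exit becomes opposite the flipped facet, and conversely: a single turn exchanges the two
  roles.\<close>

lemma perspectivity_turn:
  assumes f: "f \<in> flags T"
  shows "perspectivity T (snd f) (opposite T (snd f)) = opposite T (snd (flip T (turn T f)))"
    and "perspectivity T (snd f) (opposite T (snd (flip T f))) = opposite T (snd (turn T f))"
proof -
  have \<tau>: "snd f \<in> facets T" using f by (simp add: flags_def case_prod_beta)
  have "flip T (turn T f) = cross T f" using flip cross[OF f] by (simp add: turn_eq[OF f])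
  then have "snd (flip T (turn T f)) = mate T (snd f)" by (simp add: cross_def case_prod_beta)
  then show "perspectivity T (snd f) (opposite T (snd f)) = opposite T (snd (flip T (turn T f)))"
    by (simp add: perspectivity_opposite[OF \<tau>])
  obtain \<rho> y x where *: "f = (\<rho>, insert y \<rho>)" "y \<notin> \<rho>" using f by (rule flagE)
  define \<phi> where "\<phi> = pairing T (insert y \<rho>)"
  have inj: "inj_on \<phi> (insert y \<rho>)" using inj_on_pairing[OF \<tau>] * by (simp add: \<phi>_def)
  have cr: "cross T f = (\<phi> ` \<rho>, insert (\<phi> y) (\<phi> ` \<rho>))"
    by (simp add: * cross_def mate_def \<phi>_def)
  have "\<phi> y \<notin> \<phi> ` \<rho>" using inj *(2) by (simp add: inj_on_def) blast
  then have "opposite T (snd (turn T f)) = \<phi> y"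
    using cross[OF f] unfolding turn_eq[OF f] cr by (intro opposite_flip) simp_all
  moreover have "opposite T (snd (flip T f)) = y"
    using opposite_flip[of \<rho> y] f * by simp
  ultimately show "perspectivity T (snd f) (opposite T (snd (flip T f))) = opposite T (snd (turn T f))"
    by (simp add: * \<phi>_def perspectivity_vertex)
qed

lemma dual_path_turn_path:
  assumes "f \<in> flags T"
  shows "dual_path T (simplex_of T (snd f)) (turn_path T f k) (simplex_of T (snd ((turn T ^^ k) f)))"
proof (induction k)
  case (Suc k)
  let ?g = "(turn T ^^ k) f"
  have g: "?g \<in> flags T" using assms by (rule funpow_turn_in_flags)
  then have \<tau>: "snd ?g \<in> facets T" by (simp add: flags_def case_prod_beta)
  have "simplex_of T (snd (turn T ?g)) = simplex_of T (mate T (snd ?g))"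
    using simplex_of_flip[of "cross T ?g"] cross[OF g] unfolding turn_eq[OF g]
    by (simp add: cross_def case_prod_beta)
  then have "dual_path T (simplex_of T (snd ?g)) [snd ?g] (simplex_of T (snd (turn T ?g)))"
    using \<tau> facetD(2)[OF \<tau>] by simp
  with Suc.IH show ?case by (auto simp: dual_path_append)
qed simp

text \<open>Roles are exchanged once per turn, so only the parity of \<open>k\<close> decides which
  vertex results.\<close>

lemma fold_turn_path_opposite:
  assumes "f \<in> flags T"
  shows "fold (perspectivity T) (turn_path T f k) (opposite T (snd f)) =
      opposite T (snd (if even k then (turn T ^^ k) f else flip T ((turn T ^^ k) f)))"
    and "fold (perspectivity T) (turn_path T f k) (opposite T (snd (flip T f))) =
      opposite T (snd (if even k then flip T ((turn T ^^ k) f) else (turn T ^^ k) f))"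
  using perspectivity_turn[OF funpow_turn_in_flags[OF assms]]
  by (induction k) simp_all

text \<open>The composed perspectivities are controlled only at vertices. The affine map
  \<open>g\<close> extends their restriction to the face over its hull in a way compatible with the
  quotient map, as \<open>self_gluing_trivial\<close> requires.\<close>

lemma turn_path_affine:
  assumes f: "f \<in> flags T"
  shows "\<exists>g L c. linear L \<and> (\<forall>x\<in>convex hull (fst f). g x = L x + c) \<and>
     g ` fst f = fst ((turn T ^^ k) f) \<and> (\<forall>x\<in>convex hull (fst f). quot T (g x) = quot T x) \<and>
     (\<forall>w\<in>fst f. fold (perspectivity T) (turn_path T f k) w = g w)"
proof (induction k)
  case 0
  show ?case by (intro exI[of _ "\<lambda>x. x"] exI[of _ 0]) (simp add: linear_ident)
next
  case (Suc k)
  let ?h = "(turn T ^^ k) f" and ?\<tau> = "snd ((turn T ^^ k) f)"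
  obtain g L c where L: "linear L" and g: "\<forall>x\<in>convex hull (fst f). g x = L x + c"
    and img: "g ` fst f = fst ?h" and q: "\<forall>x\<in>convex hull (fst f). quot T (g x) = quot T x"
    and p: "\<forall>w\<in>fst f. fold (perspectivity T) (turn_path T f k) w = g w"
    using Suc.IH by (elim exE conjE)
  have \<tau>: "?\<tau> \<in> facets T" "fst ?h \<subseteq> ?\<tau>"
    using funpow_turn_in_flags[OF f, of k] by (simp_all add: flags_def case_prod_beta)
  obtain L' c' where L': "linear L'" and c': "\<forall>x\<in>convex hull ?\<tau>. pairing T ?\<tau> x = L' x + c'"
    using pairing_affine[OF \<tau>(1)] by auto
  have "g ` (convex hull (fst f)) = convex hull (fst ?h)"
    unfolding img[symmetric] by (rule rel_interior_convex_hull_affine_image(1)[OF L]) (rule bspec[OF g])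
  then have in\<tau>: "g x \<in> convex hull ?\<tau>" if "x \<in> convex hull (fst f)" for x
    using subsetD[OF hull_mono[OF \<tau>(2)], of "g x" convex] imageI[OF that, of g] by simp
  let ?g = "\<lambda>x. pairing T ?\<tau> (g x)"
  have "linear (L' \<circ> L)" using L L' by (rule linear_compose)
  moreover have "\<forall>x\<in>convex hull (fst f). ?g x = (L' \<circ> L) x + (L' c + c')"
    using in\<tau> c' g by (simp add: linear_add[OF L'])
  moreover have "?g ` fst f = fst ((turn T ^^ Suc k) f)"
    by (simp add: fst_turn img[symmetric] image_image)
  moreover have "\<forall>x\<in>convex hull (fst f). quot T (?g x) = quot T x"
    using q quot_pairing[OF \<tau>(1) in\<tau>] by simp
  moreover have "\<forall>w\<in>fst f. fold (perspectivity T) (turn_path T f (Suc k)) w = ?g w"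
  proof
    fix w assume w: "w \<in> fst f"
    then have "g w \<in> ?\<tau>" using img \<tau>(2) by auto
    then show "fold (perspectivity T) (turn_path T f (Suc k)) w = ?g w"
      using bspec[OF p w] by (simp add: perspectivity_vertex)
  qed
  ultimately show ?case by (intro exI conjI)
qed

text \<open>After one period \<open>g\<close> maps the face onto itself, so
  \<open>self_gluing_trivial\<close> applies in codimension two.\<close>

lemma fold_turn_path_face:
  assumes f: "f \<in> flags T" and w: "w \<in> fst f"
  shows "fold (perspectivity T) (turn_path T f (turn_period T f)) w = w"
proof -
  obtain g L c where L: "linear L" and g: "\<forall>x\<in>convex hull (fst f). g x = L x + c"
    and img: "g ` fst f = fst ((turn T ^^ turn_period T f) f)"
    and q: "\<forall>x\<in>convex hull (fst f). quot T (g x) = quot T x"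
    and p: "\<forall>w\<in>fst f. fold (perspectivity T) (turn_path T f (turn_period T f)) w = g w"
    using turn_path_affine[OF f, of "turn_period T f"] by (elim exE conjE)
  have "g w = w"
    using bspec[OF g] img bspec[OF q] turn_period(2)[OF f]
    by (intro self_gluing_trivial[OF fst_flag_face[OF f] _ L _ _ _ w, of g c]) simp_all
  then show ?thesis using bspec[OF p w] by simp
qed

text \<open>The face is fixed pointwise in any case; its two remaining vertices are distinct, so an
  odd period really moves them.\<close>

lemma fold_turn_path_id_iff:
  assumes f: "f \<in> flags T"
  shows "(\<forall>w\<in>simplex_of T (snd f). fold (perspectivity T) (turn_path T f (turn_period T f)) w = w)
    \<longleftrightarrow> even (turn_period T f)"
  using fold_turn_path_opposite[OF f, of "turn_period T f"] fold_turn_path_face[OF f]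
    turn_period(2)[OF f] simplex_of_flag[OF f] by auto

section \<open>Connectedness of the dual graph\<close>

text \<open>These sets are the unions of connected components of the dual graph.\<close>

definition mate_closed :: "'a set set \<Rightarrow> bool" where
  "mate_closed A \<longleftrightarrow> A \<subseteq> simplices T \<and>
     (\<forall>\<tau>\<in>facets T. simplex_of T \<tau> \<in> A \<longrightarrow> simplex_of T (mate T \<tau>) \<in> A)"

text \<open>Since \<open>mate\<close> is an involution, adjacency is symmetric and a closed set
  cannot be entered from outside.\<close>

lemma mate_closed_Diff:
  assumes "mate_closed A"
  shows "mate_closed (simplices T - A)"
  unfolding mate_closed_def
proof (intro conjI ballI impI)
  fix \<tau> assume \<tau>: "\<tau> \<in> facets T" and notin: "simplex_of T \<tau> \<in> simplices T - A"
  have "simplex_of T (mate T \<tau>) \<notin> A"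
  proof
    assume "simplex_of T (mate T \<tau>) \<in> A"
    then have "simplex_of T (mate T (mate T \<tau>)) \<in> A"
      using assms pairing_facet[OF \<tau>] unfolding mate_closed_def by simp
    then show False using notin mate_mate[OF \<tau>] by simp
  qed
  then show "simplex_of T (mate T \<tau>) \<in> simplices T - A"
    using facetD(1)[OF pairing_facet[OF \<tau>]] by simp
qed simp

text \<open>By disjointness of the hulls, the facet used by a gluing belongs to the simplex that
  contains the point, so each step stays within \<open>A\<close>.\<close>

lemma mate_closed_saturated:
  assumes A: "mate_closed A" and xy: "(x, y) \<in> (glue T)\<^sup>*" and x: "x \<in> (\<Union>\<sigma>\<in>A. convex hull \<sigma>)"
  shows "y \<in> (\<Union>\<sigma>\<in>A. convex hull \<sigma>)"
  using xy
proof (induction rule: rtrancl_induct)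
  case base
  show ?case by (rule x)
next
  case (step y z)
  obtain \<tau> where \<tau>: "\<tau> \<in> facets T" "y \<in> convex hull \<tau>" "z = pairing T \<tau> y"
    using step.hyps(2) by (auto simp: glue_def)
  obtain \<sigma> where \<sigma>: "\<sigma> \<in> A" "y \<in> convex hull \<sigma>" using step.IH by blast
  have "\<sigma> \<in> simplices T" using A \<sigma>(1) by (auto simp: mate_closed_def)
  moreover have "y \<in> convex hull (simplex_of T \<tau>)"
    using subsetD[OF hull_mono[OF facetD(2)[OF \<tau>(1)]] \<tau>(2)] .
  ultimately have "\<sigma> = simplex_of T \<tau>"
    using simplices_disjoint[OF _ facetD(1)[OF \<tau>(1)], of \<sigma>] \<sigma>(2) by auto
  then have "simplex_of T (mate T \<tau>) \<in> A" using A \<sigma>(1) \<tau>(1) by (auto simp: mate_closed_def)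
  moreover have "z \<in> convex hull (mate T \<tau>)"
    unfolding mate_def pairing_hull(1)[OF \<tau>(1) subset_refl, symmetric] \<tau>(3) using \<tau>(2) by (rule imageI)
  then have "z \<in> convex hull (simplex_of T (mate T \<tau>))"
    by (rule subsetD[OF hull_mono[OF facetD(2)[OF pairing_facet[OF \<tau>(1)]]]])
  ultimately show ?case by (rule UN_I)
qed

lemma hulls_Diff:
  assumes "A \<subseteq> simplices T"
  shows "(\<Union>\<sigma>\<in>A. convex hull \<sigma>) = total_space T - (\<Union>\<sigma>\<in>simplices T - A. convex hull \<sigma>)"
proof (intro equalityI subsetI)
  fix x assume "x \<in> (\<Union>\<sigma>\<in>A. convex hull \<sigma>)"
  then obtain \<sigma> where \<sigma>: "\<sigma> \<in> A" "x \<in> convex hull \<sigma>" by (rule UN_E)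
  have "x \<notin> convex hull \<sigma>'" if "\<sigma>' \<in> simplices T - A" for \<sigma>'
    using simplices_disjoint[of \<sigma> \<sigma>'] subsetD[OF assms \<sigma>(1)] \<sigma> that by auto
  then show "x \<in> total_space T - (\<Union>\<sigma>\<in>simplices T - A. convex hull \<sigma>)"
    using subsetD[OF assms \<sigma>(1)] \<sigma>(2) by (auto simp: total_space_def)
qed (auto simp: total_space_def)

lemma closed_hulls:
  assumes "A \<subseteq> simplices T"
  shows "closed (\<Union>\<sigma>\<in>A. convex hull \<sigma>)"
proof (rule closed_UN)
  show "finite A" using assms finite_simplices by (rule finite_subset)
  show "\<forall>\<sigma>\<in>A. closed (convex hull \<sigma>)"
    using assms finite_simplex by (auto intro!: compact_imp_closed finite_imp_compact_convex_hull)
qed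

text \<open>By saturation the preimage is the union of hulls itself, which is open in the total
  space because its complement there is a finite union of compact hulls.\<close>

lemma openin_quotient_hulls:
  assumes A: "mate_closed A"
  shows "openin (quotient_space T) (quot T ` (\<Union>\<sigma>\<in>A. convex hull \<sigma>))"
proof -
  let ?H = "\<Union>\<sigma>\<in>A. convex hull \<sigma>"
  have sub: "A \<subseteq> simplices T" using A by (simp add: mate_closed_def)
  have H: "?H \<subseteq> total_space T" unfolding total_space_def using sub by (rule UN_mono) simp
  have "{x \<in> total_space T. quot T x \<in> quot T ` ?H} = ?H"
  proof (intro equalityI subsetI)
    fix x assume "x \<in> {x \<in> total_space T. quot T x \<in> quot T ` ?H}"
    then obtain y where y: "y \<in> ?H" "quot T y = quot T x" by auto
    show "x \<in> ?H" by (rule mate_closed_saturated[OF A iffD1[OF quot_eq_iff y(2)] y(1)])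
  next
    fix x assume "x \<in> ?H"
    then show "x \<in> {x \<in> total_space T. quot T x \<in> quot T ` ?H}"
      using H by (intro CollectI conjI imageI) (rule subsetD)
  qed
  moreover have "openin (top_of_set (total_space T)) ?H"
    unfolding hulls_Diff[OF sub]
  proof (intro openin_diff openin_subtopology_self closed_subset closed_hulls)
    show "(\<Union>\<sigma>\<in>simplices T - A. convex hull \<sigma>) \<subseteq> total_space T"
      unfolding total_space_def by (rule UN_mono) simp_all
  qed simp
  moreover have "quot T ` ?H \<subseteq> topspace (quotient_space T)"
    using quotient_map_quot[of T] image_mono[OF H, of "quot T"] by (simp add: quotient_map_def)
  then have "openin (top_of_set (total_space T)) {x \<in> total_space T. quot T x \<in> quot T ` ?H} \<longleftrightarrow>
      openin (quotient_space T) (quot T ` ?H)"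
    using conjunct2[OF quotient_map_quot[of T, unfolded quotient_map_def]] by simp
  ultimately show ?thesis by simp
qed

text \<open>Otherwise the simplices reachable from \<open>\<sigma>\<close> and the remaining ones
  would have disjoint nonempty open images covering the quotient.\<close>

lemma dual_path_exists:
  assumes \<sigma>: "\<sigma> \<in> simplices T" and \<sigma>': "\<sigma>' \<in> simplices T"
  shows "\<exists>\<gamma>. dual_path T \<sigma> \<gamma> \<sigma>'"
proof (rule ccontr)
  assume no: "\<nexists>\<gamma>. dual_path T \<sigma> \<gamma> \<sigma>'"
  define A where "A = {\<sigma>1 \<in> simplices T. \<exists>\<gamma>. dual_path T \<sigma> \<gamma> \<sigma>1}"
  have A: "mate_closed A"
    unfolding mate_closed_def
  proof (intro conjI ballI impI)
    show "A \<subseteq> simplices T" by (auto simp: A_def)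
    fix \<tau> assume \<tau>: "\<tau> \<in> facets T" and "simplex_of T \<tau> \<in> A"
    then obtain \<gamma> where "dual_path T \<sigma> \<gamma> (simplex_of T \<tau>)" by (auto simp: A_def)
    then have "dual_path T \<sigma> (\<gamma> @ [\<tau>]) (simplex_of T (mate T \<tau>))"
      using \<tau> facetD(2)[OF \<tau>] by (auto simp: dual_path_append)
    then show "simplex_of T (mate T \<tau>) \<in> A"
      using facetD(1)[OF pairing_facet[OF \<tau>]] by (auto simp: A_def)
  qed
  let ?B = "simplices T - A"
  let ?U = "quot T ` (\<Union>\<sigma>\<in>A. convex hull \<sigma>)" and ?V = "quot T ` (\<Union>\<sigma>\<in>?B. convex hull \<sigma>)"
  have "dual_path T \<sigma> [] \<sigma>" by simp
  then have "\<sigma> \<in> A" using \<sigma> unfolding A_def by blast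
  moreover have "\<sigma>' \<in> ?B" using no \<sigma>' by (simp add: A_def)
  moreover have "\<sigma> \<noteq> {}" "\<sigma>' \<noteq> {}" using simplex_card \<sigma> \<sigma>' by fastforce+
  ultimately have ne: "?U \<noteq> {}" "?V \<noteq> {}" by auto
  have "?U \<inter> ?V = {}"
  proof (rule ccontr)
    assume "?U \<inter> ?V \<noteq> {}"
    then obtain x y where x: "x \<in> (\<Union>\<sigma>\<in>A. convex hull \<sigma>)" and y: "y \<in> (\<Union>\<sigma>\<in>?B. convex hull \<sigma>)"
      and eq: "quot T x = quot T y" by blast
    have "y \<in> (\<Union>\<sigma>\<in>A. convex hull \<sigma>)"
      by (rule mate_closed_saturated[OF A iffD1[OF quot_eq_iff eq] x])
    moreover have "A \<subseteq> simplices T" using A by (simp add: mate_closed_def)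
    ultimately show False using hulls_Diff y by blast
  qed
  moreover have "topspace (quotient_space T) \<subseteq> ?U \<union> ?V"
  proof -
    have "topspace (quotient_space T) = quot T ` total_space T"
      using quotient_map_quot[of T] by (simp add: quotient_map_def)
    moreover have "total_space T \<subseteq> (\<Union>\<sigma>\<in>A. convex hull \<sigma>) \<union> (\<Union>\<sigma>\<in>?B. convex hull \<sigma>)"
      unfolding total_space_def by blast
    ultimately show ?thesis unfolding image_Un[symmetric] by (simp only: image_mono)
  qed
  moreover note openin_quotient_hulls[OF A] openin_quotient_hulls[OF mate_closed_Diff[OF A]]
  ultimately have "\<not> connected_space (quotient_space T)"
    unfolding connected_space_def not_not by (intro exI[of _ ?U] exI[of _ ?V] conjI ne)
  then show False using quotient_connected by (rule notE)
qed

section \<open>Invariance under elementary moves\<close>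

text \<open>The period is positive, so the path has a first facet \<open>snd f\<close>, which fixes
  the starting simplex; after one period the flag, and with it the simplex, has returned.\<close>

lemma turn_path_closed:
  assumes f: "f \<in> flags T" and path: "dual_path T \<sigma> (turn_path T f (turn_period T f)) \<sigma>'"
    and \<sigma>: "\<sigma> \<in> simplices T"
  shows "\<sigma> = simplex_of T (snd f)" "\<sigma>' = \<sigma>"
proof -
  let ?c = "turn_path T f (turn_period T f)"
  obtain k where "turn_period T f = Suc k" using turn_period(1)[OF f] gr0_implies_Suc by blast
  then have "?c = snd f # map (\<lambda>j. snd ((turn T ^^ j) f)) [Suc 0..<turn_period T f]"
    unfolding turn_path_def by (subst upt_conv_Cons) simp_all
  then have c: "hd ?c = snd f" "?c = hd ?c # tl ?c" by simp_all
  then have "snd f \<in> facets T" "snd f \<subseteq> \<sigma>" using path by (metis dual_path.simps(2))+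
  then show \<sigma>_eq: "\<sigma> = simplex_of T (snd f)" using \<sigma> by (intro simplex_of_facet[symmetric])
  have "dual_path T \<sigma> ?c \<sigma>"
    using dual_path_turn_path[OF f, of "turn_period T f"] unfolding turn_period(2)[OF f] \<sigma>_eq .
  with path show "\<sigma>' = \<sigma>" by (rule dual_path_unique)
qed

text \<open>Common form of both kinds of move: a closed piece \<open>m\<close> is deleted at the end
  of \<open>u\<close>. Evenness is kept as a premise of the last clause so that the rule also serves
  where only the path structure matters.\<close>

lemma elementary_moveE:
  assumes "(a, b) \<in> elementary_moves T \<sigma>0" "\<sigma>0 \<in> simplices T"
  obtains u m v \<sigma> where "a = u @ m @ v" "b = u @ v" "\<sigma> \<in> simplices T"
    "dual_path T \<sigma>0 u \<sigma>" "dual_path T \<sigma> m \<sigma>" "dual_path T \<sigma> v \<sigma>0"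
    "even_triangulation T \<longrightarrow> (\<forall>w\<in>\<sigma>. fold (perspectivity T) m w = w)"
proof -
  obtain u m v where a: "a = u @ m @ v" "b = u @ v" "dual_path T \<sigma>0 a \<sigma>0"
    and m: "(\<exists>\<tau>. m = [\<tau>, mate T \<tau>]) \<or> m \<in> cell_boundaries T"
  proof -
    from assms(1) consider
      u v \<tau> where "a = u @ [\<tau>, mate T \<tau>] @ v" "b = u @ v" "a \<in> dual_loops T \<sigma>0" |
      u v c where "a = u @ c @ v" "b = u @ v" "c \<in> cell_boundaries T" "a \<in> dual_loops T \<sigma>0"
      unfolding elementary_moves_def by auto
    then show thesis
      by cases (use that in \<open>unfold dual_loops_def, blast+\<close>)
  qed
  then obtain \<sigma> \<sigma>' where p: "dual_path T \<sigma>0 u \<sigma>" "dual_path T \<sigma> m \<sigma>'" "dual_path T \<sigma>' v \<sigma>0"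
    by (auto simp: dual_path_append)
  have \<sigma>: "\<sigma> \<in> simplices T" using p(1) assms(2) by (rule dual_path_simplex)
  have "\<sigma>' = \<sigma> \<and> (even_triangulation T \<longrightarrow> (\<forall>w\<in>\<sigma>. fold (perspectivity T) m w = w))"
    using m
  proof
    assume "\<exists>\<tau>. m = [\<tau>, mate T \<tau>]"
    then obtain \<tau> where m: "m = [\<tau>, mate T \<tau>]" by (rule exE)
    show ?thesis using dual_path_back_and_forth[OF p(2)[unfolded m] \<sigma>] m by simp
  next
    assume "m \<in> cell_boundaries T"
    then obtain f where f: "f \<in> flags T" and m: "m = turn_path T f (turn_period T f)"
      unfolding cell_boundaries_eq by blast
    note closed = turn_path_closed[OF f p(2)[unfolded m] \<sigma>]
    show ?thesis
      using closed(2) fold_turn_path_id_iff[OF f] f unfolding m closed(1) even_triangulation_iff by simp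
  qed
  then show ?thesis using that[OF a(1,2) \<sigma> p(1)] p(2,3) by simp
qed

lemma projectivity_eq_fold: "w \<in> \<sigma>0 \<Longrightarrow> projectivity T \<sigma>0 \<gamma> w = fold (perspectivity T) \<gamma> w"
  by (simp add: projectivity_def)

lemma projectivity_elementary_move:
  assumes "even_triangulation T" "\<sigma>0 \<in> simplices T" "(a, b) \<in> elementary_moves T \<sigma>0"
  shows "projectivity T \<sigma>0 a = projectivity T \<sigma>0 b"
proof -
  obtain u m v \<sigma> where a: "a = u @ m @ v" "b = u @ v" and p: "dual_path T \<sigma>0 u \<sigma>"
    and m: "even_triangulation T \<longrightarrow> (\<forall>w\<in>\<sigma>. fold (perspectivity T) m w = w)"
    using assms(3,2) by (rule elementary_moveE)
  have "fold (perspectivity T) m (fold (perspectivity T) u w) = fold (perspectivity T) u w"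
    if "w \<in> \<sigma>0" for w
    using mp[OF m assms(1)] bij_betw_apply[OF bij_betw_fold_perspectivity[OF p assms(2)] that] by (rule bspec)
  then show ?thesis unfolding projectivity_def a by (intro restrict_ext) simp
qed

end

section \<open>Loop classes and their product\<close>

lemma equiv_loop_moves: "equiv UNIV ((elementary_moves T \<sigma>0 \<union> (elementary_moves T \<sigma>0)\<inverse>)\<^sup>*)"
  unfolding equiv_def
  by (simp add: refl_rtrancl trans_rtrancl sym_rtrancl sym_Un_converse)

lemma loop_class_eq_iff:
  "loop_class T \<sigma>0 \<gamma> = loop_class T \<sigma>0 \<delta> \<longleftrightarrow>
     (\<gamma>, \<delta>) \<in> (elementary_moves T \<sigma>0 \<union> (elementary_moves T \<sigma>0)\<inverse>)\<^sup>*"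
  unfolding loop_class_def by (simp add: equiv_class_eq_iff[OF equiv_loop_moves])

lemma mem_loop_class_iff: "\<delta> \<in> loop_class T \<sigma>0 \<gamma> \<longleftrightarrow> loop_class T \<sigma>0 \<gamma> = loop_class T \<sigma>0 \<delta>"
  unfolding loop_class_eq_iff by (simp add: loop_class_def)

context triangulation_dim_ge_2
begin

lemma dual_loops_append: "a \<in> dual_loops T \<sigma>0 \<Longrightarrow> b \<in> dual_loops T \<sigma>0 \<Longrightarrow> a @ b \<in> dual_loops T \<sigma>0"
  by (auto simp: dual_loops_def dual_path_append)

lemma elementary_move_loops:
  assumes "(a, b) \<in> elementary_moves T \<sigma>0" "\<sigma>0 \<in> simplices T"
  shows "a \<in> dual_loops T \<sigma>0" "b \<in> dual_loops T \<sigma>0"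
proof -
  obtain u m v \<sigma> where "a = u @ m @ v" "b = u @ v"
    "dual_path T \<sigma>0 u \<sigma>" "dual_path T \<sigma> m \<sigma>" "dual_path T \<sigma> v \<sigma>0"
    using assms by (rule elementary_moveE)
  then show "a \<in> dual_loops T \<sigma>0" "b \<in> dual_loops T \<sigma>0"
    by (auto simp: dual_loops_def dual_path_append)
qed

lemma elementary_move_append:
  assumes ab: "(a, b) \<in> elementary_moves T \<sigma>0" and "\<sigma>0 \<in> simplices T"
    and loops: "x \<in> dual_loops T \<sigma>0" "y \<in> dual_loops T \<sigma>0"
  shows "(x @ a @ y, x @ b @ y) \<in> elementary_moves T \<sigma>0"
proof -
  have loop: "x @ a @ y \<in> dual_loops T \<sigma>0"
    using loops elementary_move_loops(1)[OF assms(1,2)] by (intro dual_loops_append)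
  from ab consider
    u v \<tau> where "a = u @ [\<tau>, mate T \<tau>] @ v" "b = u @ v" |
    u v c where "a = u @ c @ v" "b = u @ v" "c \<in> cell_boundaries T"
    unfolding elementary_moves_def by auto
  then show ?thesis
  proof cases
    case 1
    show ?thesis
      unfolding elementary_moves_def
      by (rule UnI1, intro CollectI exI[of _ "x @ u"] exI[of _ "v @ y"] exI[of _ \<tau>])
        (use 1 loop in simp)
  next
    case 2
    show ?thesis
      unfolding elementary_moves_def
      by (rule UnI2, intro CollectI exI[of _ "x @ u"] exI[of _ "v @ y"] exI[of _ c])
        (use 2 loop in simp)
  qed
qed

text \<open>Moves are local, so they survive inside longer loops. Contexts on both sides cover left
  and right multiplication at once, with the empty loop for the absent one.\<close>

lemma loop_class_append_cong:
  assumes eq: "loop_class T \<sigma>0 a = loop_class T \<sigma>0 b" and \<sigma>0: "\<sigma>0 \<in> simplices T"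
    and loops: "x \<in> dual_loops T \<sigma>0" "y \<in> dual_loops T \<sigma>0"
  shows "loop_class T \<sigma>0 (x @ a @ y) = loop_class T \<sigma>0 (x @ b @ y)"
  using iffD1[OF loop_class_eq_iff eq]
proof (induction rule: rtrancl_induct)
  case (step b c)
  have "(x @ b @ y, x @ c @ y) \<in> elementary_moves T \<sigma>0 \<union> (elementary_moves T \<sigma>0)\<inverse>"
    using step.hyps(2) elementary_move_append[OF _ \<sigma>0 loops] by blast
  then have "loop_class T \<sigma>0 (x @ b @ y) = loop_class T \<sigma>0 (x @ c @ y)"
    unfolding loop_class_eq_iff by (rule r_into_rtrancl)
  with step.IH show ?case by (rule trans)
qed simp

lemma loop_class_loops:
  assumes eq: "loop_class T \<sigma>0 a = loop_class T \<sigma>0 b" and \<sigma>0: "\<sigma>0 \<in> simplices T" and a: "a \<in> dual_loops T \<sigma>0"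
  shows "b \<in> dual_loops T \<sigma>0"
  using iffD1[OF loop_class_eq_iff eq]
proof (induction rule: rtrancl_induct)
  case (step b c)
  then show ?case using elementary_move_loops[OF _ \<sigma>0] by blast
qed (rule a)

text \<open>The union defining the product ranges over all representatives; by the congruence every
  member of the union is the same class.\<close>

lemma pi1_mult:
  assumes \<sigma>0: "\<sigma>0 \<in> simplices T" and \<gamma>: "\<gamma> \<in> dual_loops T \<sigma>0" and \<delta>: "\<delta> \<in> dual_loops T \<sigma>0"
  shows "loop_class T \<sigma>0 \<gamma> \<otimes>\<^bsub>pi1 T \<sigma>0\<^esub> loop_class T \<sigma>0 \<delta> = loop_class T \<sigma>0 (\<delta> @ \<gamma>)"
proof -
  have nil: "[] \<in> dual_loops T \<sigma>0" by (simp add: dual_loops_def)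
  have "loop_class T \<sigma>0 (\<delta>' @ \<gamma>') = loop_class T \<sigma>0 (\<delta> @ \<gamma>)"
    if \<gamma>': "\<gamma>' \<in> loop_class T \<sigma>0 \<gamma>" and \<delta>': "\<delta>' \<in> loop_class T \<sigma>0 \<delta>" for \<gamma>' \<delta>'
  proof -
    note g = \<gamma>'[unfolded mem_loop_class_iff] and d = \<delta>'[unfolded mem_loop_class_iff]
    have "loop_class T \<sigma>0 (\<delta> @ \<gamma>) = loop_class T \<sigma>0 (\<delta> @ \<gamma>')"
      using loop_class_append_cong[OF g \<sigma>0 \<delta> nil] by simp
    also have "\<dots> = loop_class T \<sigma>0 (\<delta>' @ \<gamma>')"
      using loop_class_append_cong[OF d \<sigma>0 nil loop_class_loops[OF g \<sigma>0 \<gamma>]] by simp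
    finally show ?thesis by (rule sym)
  qed
  moreover have "\<gamma> \<in> loop_class T \<sigma>0 \<gamma>" "\<delta> \<in> loop_class T \<sigma>0 \<delta>"
    by (simp_all add: mem_loop_class_iff)
  ultimately have "(\<Union>\<gamma>'\<in>loop_class T \<sigma>0 \<gamma>. \<Union>\<delta>'\<in>loop_class T \<sigma>0 \<delta>. loop_class T \<sigma>0 (\<delta>' @ \<gamma>'))
      = loop_class T \<sigma>0 (\<delta> @ \<gamma>)"
    by blast
  then show ?thesis by (simp add: pi1_def)
qed

section \<open>Projectivities as permutations of the base simplex\<close>

lemma projectivity_Bij:
  assumes "\<sigma>0 \<in> simplices T" "\<gamma> \<in> dual_loops T \<sigma>0"
  shows "projectivity T \<sigma>0 \<gamma> \<in> Bij \<sigma>0"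
proof -
  have "bij_betw (fold (perspectivity T) \<gamma>) \<sigma>0 \<sigma>0"
    using assms by (intro bij_betw_fold_perspectivity) (simp_all add: dual_loops_def)
  moreover have "bij_betw (projectivity T \<sigma>0 \<gamma>) \<sigma>0 \<sigma>0 \<longleftrightarrow> bij_betw (fold (perspectivity T) \<gamma>) \<sigma>0 \<sigma>0"
    by (rule bij_betw_cong) (rule projectivity_eq_fold)
  ultimately show ?thesis by (simp add: Bij_def projectivity_def)
qed

text \<open>\<open>fold\<close> runs through \<open>\<delta>\<close> first, which matches
  composition in \<open>BijGroup\<close>; both sides are restricted to \<open>\<sigma>0\<close>, so
  they agree as functions.\<close>

lemma projectivity_append:
  assumes "\<sigma>0 \<in> simplices T" "\<gamma> \<in> dual_loops T \<sigma>0" "\<delta> \<in> dual_loops T \<sigma>0"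
  shows "projectivity T \<sigma>0 (\<delta> @ \<gamma>) = projectivity T \<sigma>0 \<gamma> \<otimes>\<^bsub>BijGroup \<sigma>0\<^esub> projectivity T \<sigma>0 \<delta>"
proof -
  note Bij = projectivity_Bij[OF assms(1,2)] projectivity_Bij[OF assms(1,3)]
  have "projectivity T \<sigma>0 \<delta> w \<in> \<sigma>0" if "w \<in> \<sigma>0" for w
    using Bij(2) that by (auto simp: Bij_def intro: bij_betw_apply)
  then have "projectivity T \<sigma>0 (\<delta> @ \<gamma>) = compose \<sigma>0 (projectivity T \<sigma>0 \<gamma>) (projectivity T \<sigma>0 \<delta>)"
    unfolding compose_def projectivity_def[of T \<sigma>0 "\<delta> @ \<gamma>"]
    by (intro restrict_ext) (simp add: projectivity_eq_fold)
  then show ?thesis using Bij by (simp add: BijGroup_def)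
qed

lemma projectivity_hom_if_even:
  assumes even: "even_triangulation T" and \<sigma>0: "\<sigma>0 \<in> simplices T"
  shows "\<exists>f \<in> hom (pi1 T \<sigma>0) (BijGroup \<sigma>0).
           \<forall>\<gamma> \<in> dual_loops T \<sigma>0. f (loop_class T \<sigma>0 \<gamma>) = projectivity T \<sigma>0 \<gamma>"
proof -
  have inv: "projectivity T \<sigma>0 a = projectivity T \<sigma>0 b" if "loop_class T \<sigma>0 a = loop_class T \<sigma>0 b" for a b
    using iffD1[OF loop_class_eq_iff that]
  proof (induction rule: rtrancl_induct)
    case (step b c)
    then have "projectivity T \<sigma>0 b = projectivity T \<sigma>0 c"
      using projectivity_elementary_move[OF even \<sigma>0, of b c]
        projectivity_elementary_move[OF even \<sigma>0, of c b] by auto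
    with step.IH show ?case by (rule trans)
  qed simp
  \<comment> \<open>The map evaluates an arbitrary representative; \<open>inv\<close> shows that the
    choice is irrelevant.\<close>
  define f where "f C = projectivity T \<sigma>0 (SOME \<gamma>. \<gamma> \<in> C)" for C
  have f: "f (loop_class T \<sigma>0 \<gamma>) = projectivity T \<sigma>0 \<gamma>" for \<gamma>
  proof -
    have "\<gamma> \<in> loop_class T \<sigma>0 \<gamma>" by (simp add: mem_loop_class_iff)
    then have "(SOME \<gamma>'. \<gamma>' \<in> loop_class T \<sigma>0 \<gamma>) \<in> loop_class T \<sigma>0 \<gamma>" by (rule someI)
    then show ?thesis unfolding f_def mem_loop_class_iff by (rule inv[symmetric])
  qed
  have "f \<in> hom (pi1 T \<sigma>0) (BijGroup \<sigma>0)"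
  proof (rule homI)
    fix a assume "a \<in> carrier (pi1 T \<sigma>0)"
    then obtain \<gamma> where "\<gamma> \<in> dual_loops T \<sigma>0" "a = loop_class T \<sigma>0 \<gamma>" by (auto simp: pi1_def)
    then show "f a \<in> carrier (BijGroup \<sigma>0)" using projectivity_Bij[OF \<sigma>0] f by (simp add: BijGroup_def)
  next
    fix a b assume "a \<in> carrier (pi1 T \<sigma>0)" "b \<in> carrier (pi1 T \<sigma>0)"
    then obtain \<gamma> \<delta> where "\<gamma> \<in> dual_loops T \<sigma>0" "a = loop_class T \<sigma>0 \<gamma>"
      "\<delta> \<in> dual_loops T \<sigma>0" "b = loop_class T \<sigma>0 \<delta>" by (auto simp: pi1_def)
    then show "f (a \<otimes>\<^bsub>pi1 T \<sigma>0\<^esub> b) = f a \<otimes>\<^bsub>BijGroup \<sigma>0\<^esub> f b"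
      using f by (simp add: pi1_mult[OF \<sigma>0] projectivity_append[OF \<sigma>0])
  qed
  then show ?thesis using f by blast
qed

text \<open>A cell boundary \<open>c\<close> is brought to the base point by a path \<open>u\<close>
  to its simplex and any path \<open>v\<close> back. Since \<open>u @ c @ v\<close> and
  \<open>u @ v\<close> have one class, their projectivities agree; \<open>u\<close> is onto and
  \<open>v\<close> injective on vertices, so \<open>c\<close> acts trivially and its length is
  even.\<close>

lemma even_if_projectivity_well_defined:
  assumes \<sigma>0: "\<sigma>0 \<in> simplices T"
    and f: "\<forall>\<gamma> \<in> dual_loops T \<sigma>0. f (loop_class T \<sigma>0 \<gamma>) = projectivity T \<sigma>0 \<gamma>"
  shows "even_triangulation T"
  unfolding even_triangulation_iff
proof
  fix g assume g: "g \<in> flags T"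
  let ?c = "turn_path T g (turn_period T g)" and ?\<sigma> = "simplex_of T (snd g)"
  have \<sigma>: "?\<sigma> \<in> simplices T" using g by (intro facetD(1)) (simp add: flags_def case_prod_beta)
  obtain u where u: "dual_path T \<sigma>0 u ?\<sigma>" using dual_path_exists[OF \<sigma>0 \<sigma>] by (rule exE)
  obtain v where v: "dual_path T ?\<sigma> v \<sigma>0" using dual_path_exists[OF \<sigma> \<sigma>0] by (rule exE)
  have c: "dual_path T ?\<sigma> ?c ?\<sigma>"
    using dual_path_turn_path[OF g, of "turn_period T g"] unfolding turn_period(2)[OF g] .
  have loops: "u @ ?c @ v \<in> dual_loops T \<sigma>0" "u @ v \<in> dual_loops T \<sigma>0"
    using u c v by (auto simp: dual_loops_def dual_path_append)
  have "(u @ ?c @ v, u @ v) \<in> elementary_moves T \<sigma>0"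
    unfolding elementary_moves_def cell_boundaries_eq
    by (rule UnI2, intro CollectI exI[of _ u] exI[of _ v] exI[of _ ?c]) (use g loops(1) in simp)
  then have "loop_class T \<sigma>0 (u @ ?c @ v) = loop_class T \<sigma>0 (u @ v)"
    unfolding loop_class_eq_iff by blast
  then have proj: "projectivity T \<sigma>0 (u @ ?c @ v) = projectivity T \<sigma>0 (u @ v)"
    using bspec[OF f loops(1)] bspec[OF f loops(2)] by simp
  have "fold (perspectivity T) ?c w = w" if w: "w \<in> ?\<sigma>" for w
  proof -
    note bij = bij_betw_fold_perspectivity[OF u \<sigma>0] bij_betw_fold_perspectivity[OF v \<sigma>]
      bij_betw_fold_perspectivity[OF c \<sigma>]
    obtain w0 where w0: "w0 \<in> \<sigma>0" "w = fold (perspectivity T) u w0"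
      using w bij_betw_imp_surj_on[OF bij(1)] by blast
    have "fold (perspectivity T) v (fold (perspectivity T) ?c w) = fold (perspectivity T) v w"
      using fun_cong[OF proj, of w0] w0 by (simp add: projectivity_eq_fold)
    then show ?thesis
      using bij_betw_imp_inj_on[OF bij(2)] bij_betw_apply[OF bij(3) w] w by (simp add: inj_on_eq_iff)
  qed
  then show "even (turn_period T g)" using fold_turn_path_id_iff[OF g] by simp
qed

end

theorem lemma5:
  fixes T :: "'e::euclidean_space gluing" and \<sigma>0 :: "'e set"
  assumes "singular_triangulation T"
    and "gdim T \<ge> 3"
    and "\<sigma>0 \<in> simplices T"
  shows "(\<exists>f \<in> hom (pi1 T \<sigma>0) (BijGroup \<sigma>0).
            \<forall>\<gamma> \<in> dual_loops T \<sigma>0. f (loop_class T \<sigma>0 \<gamma>) = projectivity T \<sigma>0 \<gamma>)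
         \<longleftrightarrow> even_triangulation T"
proof -
  interpret triangulation_dim_ge_2 T
    using assms(1,2) by (simp add: triangulation_dim_ge_2_def triangulation_dim_ge_2_axioms_def)
  show ?thesis
    using projectivity_hom_if_even[OF _ assms(3)] even_if_projectivity_well_defined[OF assms(3)] by blast
qed

end
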